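(* Let $\omega\subset\mathbb{R}$ be open and $f\in\mathcal{G}_A(\omega)$. Then $f$ admits a global real analytic representative, that is, a representative $(f_\varepsilon)_\varepsilon\in\mathcal{E}_M(\omega)$ consisting of real analytic functions on $\omega$ such that for every $x_0\in\omega$ there is an open ball $B=B(x_0,r)\subset\omega$ (depending on $x_0$) with $f|_B=[(f_\varepsilon|_B)_\varepsilon]$ in $\mathcal{G}(B)$ and $$(\exists\eta>0)(\exists a>0)(\exists\varepsilon_0\in(0,1))\quad \sup_{x\in B}|f_\varepsilon^{(\alpha)}(x)|\le\eta^{\alpha+1}\alpha!\,\varepsilon^{-a},\quad 0<\varepsilon<\varepsilon_0,\ \alpha\in\mathbb{N}_0.$$
   Context: For $\omega\subset\mathbb{R}^d$ open (here $d=1$), $\mathcal{E}_M(\omega)$ is the set of nets $(f_\varepsilon)_{\varepsilon\in(0,1)}$ of smooth functions on $\omega$ such that for every compact $K\subset\omega$ and $\alpha\in\mathbb{N}_0^d$ there is $a\in\mathbb{R}$ with $\sup_{x\in K}|f_\varepsilon^{(\alpha)}(x)|=O(\varepsilon^a)$ as $\varepsilon\to0$; $\mathcal{N}(\omega)$ is the ideal of nets for which this holds for every $a\in\mathbb{R}$, every $K$ and every $\alpha$. The Colombeau algebra is $\mathcal{G}(\omega)=\mathcal{E}_M(\omega)/\mathcal{N}(\omega)$; the class of $(f_\varepsilon)_\varepsilon$ is $[(f_\varepsilon)_\varepsilon]$. $\mathcal{G}_A(\omega)$: $f\in\mathcal{G}(\omega)$ is real analytic at $x_0\in\omega$ if there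 are an open ball $B=B(x_0,r)\subset\omega$ and $(g_\varepsilon)_\varepsilon\in\mathcal{E}_M(B)$ with $f|_B=[(g_\varepsilon)_\varepsilon]$ in $\mathcal{G}(B)$ and constants $\eta>0$, $a>0$, $\varepsilon_0\in(0,1)$ such that $\sup_{x\in B}|g_\varepsilon^{(\alpha)}(x)|\le\eta^{|\alpha|+1}\alpha!\,\varepsilon^{-a}$ for $0<\varepsilon<\varepsilon_0$, $\alpha\in\mathbb{N}_0^d$. $f\in\mathcal{G}_A(\omega)$ (a real analytic generalized function) if it is real analytic at each point of $\omega$. *)

theory Defs
  imports "HOL-Analysis.Analysis" "HOL-Library.Landau_Symbols"
begin

text \<open>
  A net is a function \<open>\<epsilon> \<mapsto> f \<epsilon>\<close>, only its values for \<open>0 < \<epsilon> < 1\<close> being relevant.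
  A function on an open set \<open>\<omega>\<close> is a total function of which only the values on \<open>\<omega>\<close> are
  relevant, so the restriction of a net to a smaller open set is the net itself.
  Functions are complex-valued.
\<close>

type_synonym net = "real \<Rightarrow> real \<Rightarrow> complex"

definition nth_vderiv :: "nat \<Rightarrow> (real \<Rightarrow> complex) \<Rightarrow> real \<Rightarrow> complex" where
  "nth_vderiv n f = ((\<lambda>g x. vector_derivative g (at x)) ^^ n) f"

definition smooth_on :: "real set \<Rightarrow> (real \<Rightarrow> complex) \<Rightarrow> bool" where
  "smooth_on \<omega> f \<longleftrightarrow> (\<forall>n. \<forall>x\<in>\<omega>. nth_vderiv n f differentiable (at x))"

definition real_analytic_on :: "real set \<Rightarrow> (real \<Rightarrow> complex) \<Rightarrow> bool" where
  "real_analytic_on \<omega> f \<longleftrightarrow>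
     (\<forall>x0\<in>\<omega>. \<exists>r>0. \<exists>c :: nat \<Rightarrow> complex.
        ball x0 r \<subseteq> \<omega> \<and> (\<forall>x\<in>ball x0 r. (\<lambda>n. c n * of_real (x - x0) ^ n) sums f x))"

text \<open>
  Only nonempty compact sets are considered below: in \<^typ>\<open>real\<close> the supremum of the empty set is
  an unspecified number, while the condition for the empty set is meant to be vacuous.
\<close>

definition sup_growth :: "net \<Rightarrow> nat \<Rightarrow> real set \<Rightarrow> real \<Rightarrow> bool" where
  "sup_growth f n K a \<longleftrightarrow>
     (\<lambda>\<epsilon>. SUP x\<in>K. norm (nth_vderiv n (f \<epsilon>) x)) \<in> O[at_right 0](\<lambda>\<epsilon>. \<epsilon> powr a)"

definition smooth_nets :: "real set \<Rightarrow> net set" where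
  "smooth_nets \<omega> = {f. \<forall>\<epsilon>\<in>{0<..<1}. smooth_on \<omega> (f \<epsilon>)}"

definition moderate_nets :: "real set \<Rightarrow> net set" where
  "moderate_nets \<omega> =
     {f \<in> smooth_nets \<omega>. \<forall>K n. compact K \<and> K \<noteq> {} \<and> K \<subseteq> \<omega> \<longrightarrow> (\<exists>a. sup_growth f n K a)}"

definition negligible_nets :: "real set \<Rightarrow> net set" where
  "negligible_nets \<omega> =
     {f \<in> smooth_nets \<omega>. \<forall>K n. compact K \<and> K \<noteq> {} \<and> K \<subseteq> \<omega> \<longrightarrow> (\<forall>a. sup_growth f n K a)}"

definition colombeau_rel :: "real set \<Rightarrow> (net \<times> net) set" where
  "colombeau_rel \<omega> =
     {(f, g). f \<in> moderate_nets \<omega> \<and> g \<in> moderate_nets \<omega> \<and>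
              (\<lambda>\<epsilon> x. f \<epsilon> x - g \<epsilon> x) \<in> negligible_nets \<omega>}"

definition colombeau_algebra :: "real set \<Rightarrow> net set set" where
  "colombeau_algebra \<omega> = moderate_nets \<omega> // colombeau_rel \<omega>"

definition colombeau_class :: "real set \<Rightarrow> net \<Rightarrow> net set" where
  "colombeau_class \<omega> f = colombeau_rel \<omega> `` {f}"

text \<open>
  The restriction of a class to an open subset \<open>B\<close>. The classes in the union all coincide
  (see \<open>colombeau_restrict_class\<close> below).
\<close>

definition colombeau_restrict :: "real set \<Rightarrow> net set \<Rightarrow> net set" where
  "colombeau_restrict B F = (\<Union>f\<in>F. colombeau_class B f)"

definition analytic_bounds :: "real set \<Rightarrow> net \<Rightarrow> bool" where
  "analytic_bounds B g \<longleftrightarrow>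
     (\<exists>\<eta>>0. \<exists>a>0. \<exists>\<epsilon>\<^sub>0\<in>{0<..<1}. \<forall>\<epsilon>\<in>{0<..<\<epsilon>\<^sub>0}. \<forall>n. \<forall>x\<in>B.
        norm (nth_vderiv n (g \<epsilon>) x) \<le> \<eta> ^ (n + 1) * fact n * \<epsilon> powr (- a))"

definition real_analytic_at :: "real set \<Rightarrow> net set \<Rightarrow> real \<Rightarrow> bool" where
  "real_analytic_at \<omega> F x0 \<longleftrightarrow>
     (\<exists>r>0. ball x0 r \<subseteq> \<omega> \<and>
        (\<exists>g\<in>moderate_nets (ball x0 r).
           colombeau_restrict (ball x0 r) F = colombeau_class (ball x0 r) g \<and>
           analytic_bounds (ball x0 r) g))"

definition colombeau_analytic :: "real set \<Rightarrow> net set set" where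
  "colombeau_analytic \<omega> = {F \<in> colombeau_algebra \<omega>. \<forall>x0\<in>\<omega>. real_analytic_at \<omega> F x0}"


lemma nth_vderiv_0 [simp]: "nth_vderiv 0 f = f"
  by (simp add: nth_vderiv_def)

lemma nth_vderiv_Suc: "nth_vderiv (Suc n) f x = vector_derivative (nth_vderiv n f) (at x)"
  by (simp add: nth_vderiv_def)

lemma smooth_on_has_vector_derivative:
  assumes "smooth_on \<omega> f" "x \<in> \<omega>"
  shows "(nth_vderiv n f has_vector_derivative nth_vderiv (Suc n) f x) (at x)"
  using assms by (simp add: smooth_on_def nth_vderiv_Suc vector_derivative_works)

lemma nth_vderiv_add:
  assumes "open \<omega>" "smooth_on \<omega> f" "smooth_on \<omega> g"
  shows "x \<in> \<omega> \<Longrightarrow> nth_vderiv n (\<lambda>x. f x + g x) x = nth_vderiv n f x + nth_vderiv n g x"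
    and "x \<in> \<omega> \<Longrightarrow> nth_vderiv n (\<lambda>x. f x + g x) differentiable (at x)"
proof -
  let ?h = "\<lambda>x. f x + g x"
  have step: "(nth_vderiv n ?h has_vector_derivative nth_vderiv (Suc n) f x + nth_vderiv (Suc n) g x) (at x)"
    if "x \<in> \<omega>" and eq: "\<And>y. y \<in> \<omega> \<Longrightarrow> nth_vderiv n ?h y = nth_vderiv n f y + nth_vderiv n g y" for n x
  proof -
    have "((\<lambda>y. nth_vderiv n f y + nth_vderiv n g y) has_vector_derivative
            nth_vderiv (Suc n) f x + nth_vderiv (Suc n) g x) (at x)"
      using smooth_on_has_vector_derivative[OF assms(2) that(1)]
            smooth_on_has_vector_derivative[OF assms(3) that(1)]
      by (rule has_vector_derivative_add)
    from has_vector_derivative_transform_within_open[OF this assms(1) that(1)]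
    show ?thesis using eq by simp
  qed
  have eq: "\<forall>x\<in>\<omega>. nth_vderiv n ?h x = nth_vderiv n f x + nth_vderiv n g x" for n
  proof (induction n)
    case (Suc n)
    show ?case
      using step[of _ n] Suc by (auto simp: nth_vderiv_Suc[of n ?h] intro: vector_derivative_at)
  qed simp
  show "x \<in> \<omega> \<Longrightarrow> nth_vderiv n ?h x = nth_vderiv n f x + nth_vderiv n g x"
    using eq by simp
  show "x \<in> \<omega> \<Longrightarrow> nth_vderiv n ?h differentiable (at x)"
    using step[of x n] eq by (auto simp: has_vector_derivative_def differentiable_def)
qed

lemma nth_vderiv_uminus:
  assumes "open \<omega>" "smooth_on \<omega> f"
  shows "x \<in> \<omega> \<Longrightarrow> nth_vderiv n (\<lambda>x. - f x) x = - nth_vderiv n f x"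
    and "x \<in> \<omega> \<Longrightarrow> nth_vderiv n (\<lambda>x. - f x) differentiable (at x)"
proof -
  let ?h = "\<lambda>x. - f x"
  have step: "(nth_vderiv n ?h has_vector_derivative - nth_vderiv (Suc n) f x) (at x)"
    if "x \<in> \<omega>" and eq: "\<And>y. y \<in> \<omega> \<Longrightarrow> nth_vderiv n ?h y = - nth_vderiv n f y" for n x
  proof -
    have "((\<lambda>y. - nth_vderiv n f y) has_vector_derivative - nth_vderiv (Suc n) f x) (at x)"
      using smooth_on_has_vector_derivative[OF assms(2) that(1)]
      by (rule has_vector_derivative_minus)
    from has_vector_derivative_transform_within_open[OF this assms(1) that(1)]
    show ?thesis using eq by simp
  qed
  have eq: "\<forall>x\<in>\<omega>. nth_vderiv n ?h x = - nth_vderiv n f x" for n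
  proof (induction n)
    case (Suc n)
    show ?case
      using step[of _ n] Suc by (auto simp: nth_vderiv_Suc[of n ?h] intro: vector_derivative_at)
  qed simp
  show "x \<in> \<omega> \<Longrightarrow> nth_vderiv n ?h x = - nth_vderiv n f x"
    using eq by simp
  show "x \<in> \<omega> \<Longrightarrow> nth_vderiv n ?h differentiable (at x)"
    using step[of x n] eq by (auto simp: has_vector_derivative_def differentiable_def)
qed

lemma smooth_on_bdd_above:
  assumes "smooth_on \<omega> f" "compact K" "K \<subseteq> \<omega>"
  shows "bdd_above ((\<lambda>x. norm (nth_vderiv n f x)) ` K)"
proof -
  have "continuous_on K (\<lambda>x. norm (nth_vderiv n f x))"
    using assms
    by (intro continuous_on_norm continuous_at_imp_continuous_on)
       (auto simp: smooth_on_def intro!: differentiable_imp_continuous_within)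
  then show ?thesis
    by (intro bounded_imp_bdd_above compact_imp_bounded compact_continuous_image assms(2))
qed

lemma negligible_nets_add:
  assumes "open \<omega>" "f \<in> negligible_nets \<omega>" "g \<in> negligible_nets \<omega>"
  shows "(\<lambda>\<epsilon> x. f \<epsilon> x + g \<epsilon> x) \<in> negligible_nets \<omega>"
proof -
  let ?h = "\<lambda>\<epsilon> x. f \<epsilon> x + g \<epsilon> x"
  have smf: "smooth_on \<omega> (f \<epsilon>)" and smg: "smooth_on \<omega> (g \<epsilon>)" if "\<epsilon> \<in> {0<..<1}" for \<epsilon>
    using assms that unfolding negligible_nets_def smooth_nets_def by auto
  have "?h \<in> smooth_nets \<omega>"
    using nth_vderiv_add(2)[OF assms(1) smf smg] by (simp add: smooth_nets_def smooth_on_def)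
  moreover have "sup_growth ?h n K a" if K: "compact K" "K \<noteq> {}" "K \<subseteq> \<omega>" for n K a
  proof -
    let ?S = "\<lambda>u \<epsilon>. SUP x\<in>K. norm (nth_vderiv n (u \<epsilon>) x)"
    have le: "norm (?S ?h \<epsilon>) \<le> norm (?S f \<epsilon> + ?S g \<epsilon>)" if e: "\<epsilon> \<in> {0<..<1}" for \<epsilon>
    proof -
      have bf: "bdd_above ((\<lambda>x. norm (nth_vderiv n (f \<epsilon>) x)) ` K)"
        and bg: "bdd_above ((\<lambda>x. norm (nth_vderiv n (g \<epsilon>) x)) ` K)"
        using smooth_on_bdd_above[OF smf[OF e] K(1,3)] smooth_on_bdd_above[OF smg[OF e] K(1,3)] by auto
      have pt: "norm (nth_vderiv n (?h \<epsilon>) x) \<le> ?S f \<epsilon> + ?S g \<epsilon>" if "x \<in> K" for x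
      proof -
        have "norm (nth_vderiv n (?h \<epsilon>) x) \<le> norm (nth_vderiv n (f \<epsilon>) x) + norm (nth_vderiv n (g \<epsilon>) x)"
          using nth_vderiv_add(1)[OF assms(1) smf[OF e] smg[OF e]] that K
          by (metis norm_triangle_ineq subsetD)
        also have "\<dots> \<le> ?S f \<epsilon> + ?S g \<epsilon>"
          using cSUP_upper[OF that bf] cSUP_upper[OF that bg] by simp
        finally show ?thesis .
      qed
      then have "?S ?h \<epsilon> \<le> ?S f \<epsilon> + ?S g \<epsilon>"
        using K(2) by (intro cSUP_least)
      moreover obtain x where "x \<in> K" using K(2) by blast
      then have "0 \<le> ?S ?h \<epsilon>"
        using pt by (intro cSUP_upper2[where x = x] bdd_aboveI2[where M = "?S f \<epsilon> + ?S g \<epsilon>"]) auto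
      ultimately show ?thesis by simp
    qed
    have "eventually (\<lambda>\<epsilon>::real. \<epsilon> \<in> {0<..<1}) (at_right 0)"
      by (rule eventually_at_right_real) simp
    then have "?S ?h \<in> O[at_right 0](\<lambda>\<epsilon>. ?S f \<epsilon> + ?S g \<epsilon>)"
      by (intro landau_o.big_mono) (erule eventually_mono, rule le)
    also have "(\<lambda>\<epsilon>. ?S f \<epsilon> + ?S g \<epsilon>) \<in> O[at_right 0](\<lambda>\<epsilon>. \<epsilon> powr a)"
      using assms K unfolding negligible_nets_def sup_growth_def
      by (intro sum_in_bigo) auto
    finally show ?thesis unfolding sup_growth_def .
  qed
  ultimately show ?thesis unfolding negligible_nets_def by auto
qed

lemma negligible_nets_uminus:
  assumes "open \<omega>" "f \<in> negligible_nets \<omega>"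
  shows "(\<lambda>\<epsilon> x. - f \<epsilon> x) \<in> negligible_nets \<omega>"
proof -
  let ?h = "\<lambda>\<epsilon> x. - f \<epsilon> x"
  have sm: "smooth_on \<omega> (f \<epsilon>)" if "\<epsilon> \<in> {0<..<1}" for \<epsilon>
    using assms that unfolding negligible_nets_def smooth_nets_def by auto
  have "?h \<in> smooth_nets \<omega>"
    using nth_vderiv_uminus(2)[OF assms(1) sm] by (simp add: smooth_nets_def smooth_on_def)
  moreover have "sup_growth ?h n K a" if K: "compact K" "K \<noteq> {}" "K \<subseteq> \<omega>" for n K a
  proof -
    have ev: "eventually (\<lambda>\<epsilon>::real. \<epsilon> \<in> {0<..<1}) (at_right 0)"
      by (rule eventually_at_right_real) simp
    have "(SUP x\<in>K. norm (nth_vderiv n (?h \<epsilon>) x)) = (SUP x\<in>K. norm (nth_vderiv n (f \<epsilon>) x))"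
      if e: "\<epsilon> \<in> {0<..<1}" for \<epsilon>
      using nth_vderiv_uminus(1)[OF assms(1) sm[OF e]] K by (intro SUP_cong) auto
    then have "eventually (\<lambda>\<epsilon>. (SUP x\<in>K. norm (nth_vderiv n (?h \<epsilon>) x)) =
        (SUP x\<in>K. norm (nth_vderiv n (f \<epsilon>) x))) (at_right 0)"
      using ev by (auto elim!: eventually_mono)
    then have "sup_growth ?h n K a \<longleftrightarrow> sup_growth f n K a"
      unfolding sup_growth_def by (rule landau_o.big.in_cong)
    then show ?thesis using assms K unfolding negligible_nets_def by auto
  qed
  ultimately show ?thesis unfolding negligible_nets_def by auto
qed

lemma nth_vderiv_zero: "nth_vderiv n (\<lambda>x. 0) = (\<lambda>x. 0)"
  by (induction n) (auto simp: nth_vderiv_Suc)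

lemma negligible_nets_zero: "(\<lambda>\<epsilon> x. 0) \<in> negligible_nets \<omega>"
  by (auto simp: negligible_nets_def smooth_nets_def smooth_on_def sup_growth_def nth_vderiv_zero)

lemma equiv_colombeau_rel:
  assumes "open \<omega>"
  shows "equiv (moderate_nets \<omega>) (colombeau_rel \<omega>)"
proof (rule equivI)
  show "colombeau_rel \<omega> \<subseteq> moderate_nets \<omega> \<times> moderate_nets \<omega>"
    by (auto simp: colombeau_rel_def)
  show "refl_on (moderate_nets \<omega>) (colombeau_rel \<omega>)"
    using negligible_nets_zero by (auto simp: colombeau_rel_def refl_on_def)
  show "sym (colombeau_rel \<omega>)"
    using negligible_nets_uminus[OF assms] by (fastforce simp: colombeau_rel_def sym_def)
  show "trans (colombeau_rel \<omega>)"
    using negligible_nets_add[OF assms] by (fastforce simp: colombeau_rel_def trans_def)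
qed

lemma colombeau_rel_mono:
  assumes "B \<subseteq> \<omega>"
  shows "colombeau_rel \<omega> \<subseteq> colombeau_rel B"
proof -
  have 1: "smooth_nets \<omega> \<subseteq> smooth_nets B"
    using assms by (auto simp: smooth_nets_def smooth_on_def)
  have 2: "moderate_nets \<omega> \<subseteq> moderate_nets B"
    using assms 1 unfolding moderate_nets_def by (smt (verit) mem_Collect_eq order_trans subset_iff)
  have "negligible_nets \<omega> \<subseteq> negligible_nets B"
    using assms 1 unfolding negligible_nets_def by (smt (verit) mem_Collect_eq order_trans subset_iff)
  then show ?thesis using 2 by (auto simp: colombeau_rel_def)
qed

lemma colombeau_restrict_class:
  assumes "open \<omega>" "open B" "B \<subseteq> \<omega>" "f \<in> moderate_nets \<omega>"
  shows "colombeau_restrict B (colombeau_class \<omega> f) = colombeau_class B f"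
proof -
  have "colombeau_class B g = colombeau_class B f" if "g \<in> colombeau_class \<omega> f" for g
    using that equiv_class_eq[OF equiv_colombeau_rel[OF assms(2)], of f g]
      colombeau_rel_mono[OF assms(3)]
    by (auto simp: colombeau_class_def)
  moreover have "f \<in> colombeau_class \<omega> f"
    using equiv_class_self[OF equiv_colombeau_rel[OF assms(1)] assms(4)]
    by (simp add: colombeau_class_def)
  ultimately show ?thesis unfolding colombeau_restrict_def by blast
qed

end

theory Submission
  imports Defs "HOL-Complex_Analysis.Complex_Analysis" "HOL-Real_Asymp.Real_Asymp"
begin

text \<open>
  Let \<open>h\<close> be any representative of \<open>F\<close>. The new representative is
  \<open>f\<^sub>\<epsilon>(x) = \<integral> K\<^sub>L(x - y) \<psi>\<^sub>k(y) h\<^sub>\<epsilon>(y) dy\<close> with the entire kernel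
  \<open>K\<^sub>L(u) = sin(L u) / (\<pi> u) \<cdot> exp(- L u\<^sup>2)\<close> and cutoffs \<open>\<psi>\<^sub>k\<close> exhausting \<open>\<omega>\<close>, where
  \<open>L = l log(1/\<epsilon>)\<close> with \<open>k = \<kappa>(\<epsilon>)\<close> and \<open>l = l(k)\<close> tending to \<open>\<infinity>\<close> slowly as \<open>\<epsilon> \<rightarrow> 0\<close>.
  Splitting the sine into its two exponentials and shifting the contour down for one and up for the
  other shows that \<open>K\<^sub>L\<close> reproduces a holomorphic function up to \<open>O(e\<^bsup>-cL\<^esup>)\<close>, on a whole complex
  neighbourhood; by the Gaussian factor the part of the integral away from \<open>x\<close> is \<open>O(e\<^bsup>-cL\<^esup>)\<close> as well.
  Both are negligible since \<open>l \<rightarrow> \<infinity>\<close>. A negligible perturbation of \<open>h\<close> is amplified by at most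
  \<open>e\<^bsup>2L\<^esup> = \<epsilon>\<^bsup>-2l\<^esup>\<close>, which it absorbs if \<open>\<kappa>\<close> grows slowly enough. So near each point \<open>f\<^sub>\<epsilon>\<close> differs on a
  fixed complex disc by a negligible amount from the holomorphic extension of the local analytic
  representative, and Cauchy's estimates bound all derivatives.
\<close>

section \<open>The kernel\<close>

text \<open>The first factor is the Paley-Wiener kernel of band limit \<open>L\<close>; the value
  \<open>L / pi\<close> at 0 fills its removable singularity. The Gaussian carries the same
  parameter, so that at any fixed distance along the real axis it decays exponentially in
  \<open>L\<close>.\<close>

definition sinc_gauss :: "real \<Rightarrow> complex \<Rightarrow> complex" where
  "sinc_gauss L u =
     (if u = 0 then of_real (L / pi)
      else sin (of_real L * u) / (of_real pi * u) * exp (- of_real L * u\<^sup>2))"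

text \<open>
  For \<open>\<sigma> = \<plusminus>\<i>\<close>, the numerator of one exponential half of \<open>sinc_gauss\<close>: it decays where
  \<open>\<plusminus>Im u > 0\<close>.
\<close>

definition half_kernel :: "complex \<Rightarrow> real \<Rightarrow> complex \<Rightarrow> complex" where
  "half_kernel \<sigma> L u = exp (of_real L * (\<sigma> * u - u\<^sup>2)) / (2 * of_real pi * \<i>)"

text \<open>Euler's formula for the sine. Both halves have residue 1 / (2 pi i) at 0: the poles
  cancel in the difference, while a single half acts as a Cauchy kernel.\<close>

lemma sinc_gauss_eq_diff:
  assumes "u \<noteq> 0"
  shows "sinc_gauss L u = half_kernel \<i> L u / u - half_kernel (- \<i>) L u / u"
proof -
  have "exp (of_real L * (\<i> * u - u\<^sup>2)) = exp (\<i> * (of_real L * u)) * exp (- of_real L * u\<^sup>2)"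
    and "exp (of_real L * (- \<i> * u - u\<^sup>2)) = exp (- (\<i> * (of_real L * u))) * exp (- of_real L * u\<^sup>2)"
    by (simp_all add: exp_add [symmetric] algebra_simps)
  then show ?thesis
    using assms by (simp add: sinc_gauss_def half_kernel_def sin_exp_eq field_simps)
qed

text \<open>The kernel is the difference quotient at 0 of the entire function \<open>N\<close>,
  completed at 0 by the derivative of \<open>N\<close>, so its singularity is removable.\<close>

lemma holomorphic_sinc_gauss: "sinc_gauss L holomorphic_on UNIV"
proof -
  define N where "N u = sin (of_real L * u) / of_real pi * exp (- of_real L * u\<^sup>2)" for u :: complex
  have "(N has_field_derivative of_real (L / pi)) (at 0)"
    unfolding N_def by (auto intro!: derivative_eq_intros)
  then have deriv: "deriv N 0 = of_real (L / pi)"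
    by (rule DERIV_imp_deriv)
  have "N holomorphic_on UNIV"
    unfolding N_def by (intro holomorphic_intros) auto
  then have "(\<lambda>u. if u = 0 then of_real (L / pi) else (N u - N 0) / (u - 0)) holomorphic_on UNIV"
    unfolding deriv [symmetric] by (rule pole_lemma) simp
  moreover have "(\<lambda>u. if u = 0 then of_real (L / pi) else (N u - N 0) / (u - 0)) = sinc_gauss L"
    by (auto simp: fun_eq_iff sinc_gauss_def N_def)
  ultimately show ?thesis by simp
qed

text \<open>For \<sigma> = i or -i the left side of the last hypothesis is Re (\<sigma> u - u^2),
  which governs the size of the exponential; the denominator 2 pi exceeds 1.\<close>

lemma norm_half_kernel_le:
  assumes "\<sigma> = \<i> \<or> \<sigma> = - \<i>" and "0 \<le> L"
    and "- Im u * Im \<sigma> - (Re u)\<^sup>2 + (Im u)\<^sup>2 \<le> - c"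
  shows "norm (half_kernel \<sigma> L u) \<le> exp (- c * L)"
proof -
  have "Re (of_real L * (\<sigma> * u - u\<^sup>2)) = L * (- Im u * Im \<sigma> - (Re u)\<^sup>2 + (Im u)\<^sup>2)"
    using assms(1) by (auto simp: power2_eq_square algebra_simps)
  also have "\<dots> \<le> L * - c"
    using assms(2,3) by (intro mult_left_mono)
  finally have "norm (exp (of_real L * (\<sigma> * u - u\<^sup>2))) \<le> exp (- c * L)"
    by (simp add: norm_exp_eq_Re mult.commute)
  then have "norm (half_kernel \<sigma> L u) \<le> exp (- c * L) / (2 * pi)"
    by (simp add: half_kernel_def norm_divide norm_mult divide_right_mono)
  also have "\<dots> \<le> exp (- c * L) / 1"
    using pi_gt3 by (intro divide_left_mono) auto
  finally show ?thesis by simp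
qed

lemma
  fixes z :: complex
  shows norm_sin_complex_le: "norm (sin z) \<le> exp \<bar>Im z\<bar>"
    and norm_cos_complex_le: "norm (cos z) \<le> exp \<bar>Im z\<bar>"
proof -
  have *: "norm (exp (\<i> * z)) \<le> exp \<bar>Im z\<bar>" "norm (exp (- (\<i> * z))) \<le> exp \<bar>Im z\<bar>"
    by (auto simp: norm_exp_eq_Re)
  have "norm (exp (\<i> * z) - exp (- (\<i> * z))) \<le> 2 * exp \<bar>Im z\<bar>"
    using * by (intro order_trans [OF norm_triangle_ineq4]) linarith
  then show "norm (sin z) \<le> exp \<bar>Im z\<bar>"
    by (simp add: sin_exp_eq norm_divide norm_mult)
  have "norm (exp (\<i> * z) + exp (- (\<i> * z))) \<le> 2 * exp \<bar>Im z\<bar>"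
    using * by (intro order_trans [OF norm_triangle_ineq]) linarith
  then show "norm (cos z) \<le> exp \<bar>Im z\<bar>"
    by (simp add: cos_exp_eq norm_divide)
qed

text \<open>Mean value inequality on the strip |Im w| \<le> |Im z|, which contains 0 and where the
  derivative cos is bounded by exp |Im z|. The factor \<open>norm z\<close> later cancels the
  denominator of the kernel near 0.\<close>

lemma norm_sin_complex_le': "norm (sin z) \<le> exp \<bar>Im z\<bar> * norm z" for z :: complex
proof -
  have "convex {w::complex. \<bar>Im w\<bar> \<le> \<bar>Im z\<bar>}"
  proof -
    have "{w::complex. \<bar>Im w\<bar> \<le> \<bar>Im z\<bar>} = {w. Im w \<le> \<bar>Im z\<bar>} \<inter> {w. Im w \<ge> - \<bar>Im z\<bar>}"
      by auto
    then show ?thesis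
      by (metis convex_Int convex_halfspace_Im_le convex_halfspace_Im_ge)
  qed
  then have "norm (sin z - sin 0) \<le> exp \<bar>Im z\<bar> * norm (z - 0)"
    by (rule field_differentiable_bound [where f' = cos])
       (auto intro!: DERIV_subset [OF DERIV_sin] order_trans [OF norm_cos_complex_le])
  then show ?thesis by simp
qed

text \<open>The first bound is uniform up to 0: the sine supplies a factor L |u| against 1 / u, and
  L \<le> exp L, t + t^2 \<le> 1 bring the total to exp (2 L). The second keeps the Gaussian decay
  and serves away from 0.\<close>

lemma norm_sinc_gauss_le:
  assumes "1 \<le> L" "\<bar>Im u\<bar> \<le> t" "t \<le> 1/4"
  shows "norm (sinc_gauss L u) \<le> exp (2 * L)"
    and "u \<noteq> 0 \<Longrightarrow> norm (sinc_gauss L u) \<le> exp (L * (t + t\<^sup>2 - (Re u)\<^sup>2)) / norm u"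
proof -
  have "(Im u)\<^sup>2 \<le> t\<^sup>2"
    using assms(2) by (metis abs_ge_zero power2_abs power_mono)
  then have gauss: "norm (exp (- of_real L * u\<^sup>2)) \<le> exp (L * (t\<^sup>2 - (Re u)\<^sup>2))"
    using assms(1) by (simp add: norm_exp_eq_Re power2_eq_square algebra_simps mult_left_mono)
  have im: "\<bar>Im (of_real L * u)\<bar> \<le> L * t"
    using assms by (simp add: abs_mult mult_left_mono)
  have "norm (sin (of_real L * u)) \<le> exp (L * t)"
    by (rule order_trans [OF norm_sin_complex_le]) (use im in simp)
  then have "norm (sin (of_real L * u)) * norm (exp (- of_real L * u\<^sup>2)) \<le>
      exp (L * t) * exp (L * (t\<^sup>2 - (Re u)\<^sup>2))"
    using gauss by (intro mult_mono) auto
  also have "\<dots> = exp (L * (t + t\<^sup>2 - (Re u)\<^sup>2))"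
    by (simp add: exp_add [symmetric] algebra_simps)
  finally have num: "norm (sin (of_real L * u)) * norm (exp (- of_real L * u\<^sup>2)) \<le> \<dots>" .
  show "norm (sinc_gauss L u) \<le> exp (L * (t + t\<^sup>2 - (Re u)\<^sup>2)) / norm u" if "u \<noteq> 0"
  proof -
    have "norm (sinc_gauss L u) =
        norm (sin (of_real L * u)) * norm (exp (- of_real L * u\<^sup>2)) / norm u / pi"
      using that by (simp add: sinc_gauss_def norm_mult norm_divide field_simps)
    also have "\<dots> \<le> exp (L * (t + t\<^sup>2 - (Re u)\<^sup>2)) / norm u / 1"
      using pi_gt3 num by (intro frac_le divide_right_mono) auto
    finally show ?thesis by simp
  qed
  have Lle: "L \<le> exp L"
    using exp_ge_add_one_self [of L] by linarith
  show "norm (sinc_gauss L u) \<le> exp (2 * L)"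
  proof (cases "u = 0")
    case True
    have "L / pi \<le> L / 1"
      using pi_gt3 assms(1) by (intro divide_left_mono) auto
    also have "L / 1 \<le> exp (2 * L)"
      using Lle exp_le_cancel_iff [of L "2 * L"] assms(1) by linarith
    finally show ?thesis
      using True assms(1) by (simp add: sinc_gauss_def norm_divide)
  next
    case False
    have "t \<ge> 0" using assms(2) by linarith
    have tt: "t + t\<^sup>2 \<le> 1"
      using \<open>t \<ge> 0\<close> assms(3) power_mono [of t "1/4" 2] by (simp add: power2_eq_square)
    have "norm (sin (of_real L * u)) \<le> exp (L * t) * (L * norm u)"
    proof (rule order_trans [OF norm_sin_complex_le'])
      show "exp \<bar>Im (complex_of_real L * u)\<bar> * cmod (complex_of_real L * u) \<le> exp (L * t) * (L * norm u)"
        using im assms(1) by (intro mult_mono) (auto simp: norm_mult)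
    qed
    moreover have "norm (exp (- of_real L * u\<^sup>2)) \<le> exp (L * t\<^sup>2)"
      by (rule order_trans [OF gauss]) (use assms(1) in \<open>simp add: mult_left_mono\<close>)
    ultimately have "norm (sin (of_real L * u)) * norm (exp (- of_real L * u\<^sup>2)) \<le>
      (exp (L * t) * (L * norm u)) * exp (L * t\<^sup>2)"
      using assms(1) by (intro mult_mono) auto
    also have "\<dots> = exp (L * (t + t\<^sup>2)) * L * norm u"
      by (simp add: exp_add algebra_simps)
    also have "\<dots> \<le> exp (L * 1) * exp L * norm u"
      using tt assms(1) Lle by (intro mult_right_mono mult_mono) auto
    also have "\<dots> = exp (2 * L) * norm u"
      by (simp add: exp_add [symmetric])
    finally have "norm (sin (of_real L * u)) * norm (exp (- of_real L * u\<^sup>2)) / (norm u * pi) \<le>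
        exp (2 * L) * norm u / (norm u * 1)"
      using pi_gt3 False by (intro frac_le mult_left_mono mult_pos_pos) auto
    then show ?thesis
      using False by (simp add: sinc_gauss_def norm_mult norm_divide field_simps)
  qed
qed

section \<open>Contour shifting: reproduction of holomorphic functions\<close>

lemma contour_integral_rectpath:
  assumes "continuous_on (path_image (rectpath a c)) f"
    and "b = Complex (Re c) (Im a)" and "d = Complex (Re a) (Im c)"
  shows "contour_integral (rectpath a c) f =
    contour_integral (linepath a b) f + contour_integral (linepath b c) f +
    contour_integral (linepath c d) f + contour_integral (linepath d a) f"
proof -
  have *: "f contour_integrable_on (linepath p q)"
    if "closed_segment p q \<subseteq> path_image (rectpath a c)" for p q
    using that assms(1) by (intro contour_integrable_continuous_linepath) (rule continuous_on_subset)
  have "path_image (rectpath a c) =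
      closed_segment a b \<union> (closed_segment b c \<union> (closed_segment c d \<union> closed_segment d a))"
    unfolding rectpath_def Let_def assms(2,3) by (simp add: path_image_join)
  then have "f contour_integrable_on (linepath a b)" "f contour_integrable_on (linepath b c)"
    "f contour_integrable_on (linepath c d)" "f contour_integrable_on (linepath d a)"
    by (auto intro!: *)
  then show ?thesis
    unfolding rectpath_def Let_def assms(2,3) [symmetric] by simp
qed

text \<open>The real segment is pushed down to the bottom edge of a rectangle around
  \<open>z\<close>. There the half \<open>Qp\<close> is small; the half \<open>Qm\<close> is not,
  but Cauchy's formula over the whole boundary trades it for G z and its integrals over the other
  three edges, where it is small.\<close>

lemma sinc_gauss_reproduces:
  fixes x0 \<rho> L A :: real and z :: complex and G :: "complex \<Rightarrow> complex"
  assumes \<rho>: "0 < \<rho>" "\<rho> \<le> 1" and L: "0 \<le> L"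
    and G: "G holomorphic_on ball (of_real x0) (2 * \<rho>)"
    and A: "\<And>w. w \<in> ball (of_real x0) (2 * \<rho>) \<Longrightarrow> norm (G w) \<le> A"
    and z: "z \<in> ball (of_real x0) (\<rho>\<^sup>2 / 32)"
  shows "norm (integral {x0 - \<rho>..x0 + \<rho>} (\<lambda>y. sinc_gauss L (z - of_real y) * G (of_real y)) - G z)
    \<le> 128 / \<rho>\<^sup>2 * A * exp (- \<rho>\<^sup>2 / 16 * L)"
proof -
  \<comment> \<open>The half height s = 4 t against |Im z| < t keeps the horizontal edges at
    vertical distance between 3 t and 5 t from \<open>z\<close>. The target rate \<rho>^2 / 16
    equals 2 t, and \<open>V\<close> bounds each half on the edges where it is small.\<close>
  define s where "s = \<rho>\<^sup>2 / 8"
  define t where "t = \<rho>\<^sup>2 / 32"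
  define a where "a = Complex (x0 - \<rho>) (- s)"
  define b where "b = Complex (x0 + \<rho>) (- s)"
  define c where "c = Complex (x0 + \<rho>) s"
  define d where "d = Complex (x0 - \<rho>) s"
  define p where "p = complex_of_real (x0 - \<rho>)"
  define q where "q = complex_of_real (x0 + \<rho>)"
  define P where "P w = sinc_gauss L (z - w) * G w" for w
  define Qp where "Qp w = half_kernel \<i> L (z - w) / (z - w) * G w" for w
  define Qm where "Qm w = half_kernel (- \<i>) L (z - w) / (z - w) * G w" for w
  define V where "V = exp (- \<rho>\<^sup>2 / 16 * L) / (3 * t) * A"
  have \<rho>2: "\<rho>\<^sup>2 \<le> \<rho>" "0 < \<rho>\<^sup>2"
    using \<rho> by (auto simp: power2_eq_square mult_left_le)
  have st: "0 < s" "0 < t" "s = 4 * t" "t \<le> \<rho> / 32" "t \<le> 1/32"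
    using \<rho>2 \<rho> by (auto simp: s_def t_def)
  have Re_z: "\<bar>Re z - x0\<bar> < t" and Im_z: "\<bar>Im z\<bar> < t"
    using z abs_Re_le_cmod [of "z - of_real x0"] abs_Im_le_cmod [of "z - of_real x0"]
    by (auto simp: t_def dist_norm norm_minus_commute)
  have rect: "cbox a c \<subseteq> ball (of_real x0) (2 * \<rho>)"
  proof
    fix w assume "w \<in> cbox a c"
    then have "\<bar>Re (w - of_real x0)\<bar> \<le> \<rho>" "\<bar>Im (w - of_real x0)\<bar> \<le> s"
      by (auto simp: a_def c_def in_cbox_complex_iff)
    then have "norm (w - of_real x0) < 2 * \<rho>"
      using cmod_le [of "w - of_real x0"] st \<rho> by linarith
    then show "w \<in> ball (of_real x0) (2 * \<rho>)"
      by (simp add: dist_norm norm_minus_commute)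
  qed
  have le: "Re a \<le> Re c" "Im a \<le> Im c" "Re a \<le> Re q" "Im a \<le> Im q"
    using st \<rho> by (auto simp: a_def c_def q_def)
  have holP: "P holomorphic_on ball (of_real x0) (2 * \<rho>)"
    unfolding P_def
    by (intro holomorphic_intros G holomorphic_on_compose_gen [OF _ holomorphic_sinc_gauss, unfolded o_def]) auto
  have contP: "continuous_on S P" if "S \<subseteq> ball (of_real x0) (2 * \<rho>)" for S
    using holP that by (meson holomorphic_on_imp_continuous_on continuous_on_subset)
  have holQ: "Qp holomorphic_on ball (of_real x0) (2 * \<rho>) - {z}"
    "Qm holomorphic_on ball (of_real x0) (2 * \<rho>) - {z}"
    unfolding Qp_def Qm_def half_kernel_def
    by (auto intro!: holomorphic_intros holomorphic_on_subset [OF G])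
  have contQ: "continuous_on S Qp" "continuous_on S Qm" if "S \<subseteq> ball (of_real x0) (2 * \<rho>) - {z}" for S
    using holQ that by (meson holomorphic_on_imp_continuous_on continuous_on_subset)+
  have zbox: "z \<in> box a c"
    using Re_z Im_z st \<rho> by (auto simp: a_def c_def in_box_complex_iff)
  have path_ac: "path_image (rectpath a c) \<subseteq> ball (of_real x0) (2 * \<rho>) - {z}"
    using path_image_rectpath_subset_cbox [OF le(1,2)] path_image_rectpath_inter_box [OF le(1,2)] zbox rect
    by blast
  have path_aq: "path_image (rectpath a q) \<subseteq> ball (of_real x0) (2 * \<rho>)"
  proof -
    have "cbox a q \<subseteq> cbox a c"
      using st by (auto simp: a_def c_def q_def in_cbox_complex_iff)
    then show ?thesis
      using path_image_rectpath_subset_cbox [OF le(3,4)] rect by blast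
  qed
  have A0: "0 \<le> A"
    using norm_ge_zero order_trans A [of "of_real x0"] \<rho> by (metis centre_in_ball mult_pos_pos zero_less_numeral)
  have V0: "0 \<le> V"
    using A0 st by (simp add: V_def)

  \<comment> \<open>Cauchy's theorem on the lower half of the rectangle, whose top edge is the real
    segment: \<open>P\<close> has no pole at \<open>z\<close>, so \<open>z\<close> may lie
    inside.\<close>
  have "(P has_contour_integral 0) (rectpath a q)"
    using path_aq by (intro Cauchy_theorem_convex_simple [OF holP]) (auto simp: convex_ball)
  then have "contour_integral (rectpath a q) P = 0"
    by (rule contour_integral_unique)
  then have 1: "contour_integral (linepath a b) P + contour_integral (linepath b q) P +
      contour_integral (linepath q p) P + contour_integral (linepath p a) P = 0"
    by (subst (asm) contour_integral_rectpath [of _ _ _ b p])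
       (use contP [OF path_aq] in \<open>auto simp: a_def b_def q_def p_def complex_eq_iff\<close>)
  \<comment> \<open>The sign in \<open>E\<close> turns w - z into z - w, so that E w / (w - z) is
    \<open>Qm\<close>; the value of \<open>half_kernel\<close> at 0 cancels 2 pi i and leaves - G
    z.\<close>
  define E where "E w = - half_kernel (- \<i>) L (z - w) * G w" for w
  have "E holomorphic_on ball (of_real x0) (2 * \<rho>)"
    unfolding E_def half_kernel_def by (auto intro!: holomorphic_intros G)
  moreover have "z \<in> interior (ball (of_real x0) (2 * \<rho>))"
    using zbox box_subset_cbox [of a c] rect by (simp only: interior_open open_ball) blast
  ultimately have "((\<lambda>w. E w / (w - z)) has_contour_integral
      (2 * pi * \<i> * winding_number (rectpath a c) z * E z)) (rectpath a c)"
    using path_ac by (intro Cauchy_integral_formula_convex_simple) (auto simp: convex_ball)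
  moreover have "2 * pi * \<i> * winding_number (rectpath a c) z * E z = - G z"
    using winding_number_rectpath [OF zbox] by (simp add: E_def half_kernel_def)
  moreover have "(\<lambda>w. E w / (w - z)) = Qm"
    by (auto simp: E_def Qm_def fun_eq_iff divide_simps) (simp add: algebra_simps)
  ultimately have "contour_integral (rectpath a c) Qm = - G z"
    using contour_integral_unique by simp
  then have 2: "contour_integral (linepath a b) Qm + contour_integral (linepath b c) Qm +
      contour_integral (linepath c d) Qm + contour_integral (linepath d a) Qm = - G z"
    by (subst (asm) contour_integral_rectpath [of _ _ _ b d])
       (use contQ [OF path_ac] in \<open>auto simp: a_def b_def c_def d_def complex_eq_iff\<close>)

  have segs: "closed_segment a b \<subseteq> path_image (rectpath a c)" "closed_segment b c \<subseteq> path_image (rectpath a c)"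
    "closed_segment c d \<subseteq> path_image (rectpath a c)" "closed_segment d a \<subseteq> path_image (rectpath a c)"
  proof -
    have "b = Complex (Re c) (Im a)" "d = Complex (Re a) (Im c)"
      by (auto simp: a_def b_def c_def d_def)
    then have "path_image (rectpath a c) =
        closed_segment a b \<union> (closed_segment b c \<union> (closed_segment c d \<union> closed_segment d a))"
      unfolding rectpath_def Let_def by (simp add: path_image_join)
    then show "closed_segment a b \<subseteq> path_image (rectpath a c)" "closed_segment b c \<subseteq> path_image (rectpath a c)"
      "closed_segment c d \<subseteq> path_image (rectpath a c)" "closed_segment d a \<subseteq> path_image (rectpath a c)"
      by auto
  qed
  have sub: "closed_segment b q \<subseteq> closed_segment b c" "closed_segment p a \<subseteq> closed_segment d a"
    using st
    by (auto simp: closed_segment_same_Re a_def b_def c_def d_def p_def q_def closed_segment_eq_real_ivl)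
  have segs_ball: "S \<subseteq> ball (of_real x0) (2 * \<rho>) - {z}" if "S \<subseteq> path_image (rectpath a c)" for S
    using that path_ac by blast
  have integrable: "Qp contour_integrable_on linepath u v" "Qm contour_integrable_on linepath u v"
      "P contour_integrable_on linepath u v"
    if "closed_segment u v \<subseteq> path_image (rectpath a c)" for u v
    using contQ [OF segs_ball [OF that]] contP [of "closed_segment u v"] segs_ball [OF that]
    by (auto intro!: contour_integrable_continuous_linepath)
  have Peq: "P w = Qp w - Qm w" if "w \<noteq> z" for w
    using that sinc_gauss_eq_diff [of "z - w" L] by (simp add: P_def Qp_def Qm_def left_diff_distrib)
  \<comment> \<open>The edge avoids \<open>z\<close>, so here \<open>P\<close> may be split into the
    two halves with poles.\<close>
  have "contour_integral (linepath a b) P = contour_integral (linepath a b) (\<lambda>w. Qp w - Qm w)"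
    using segs_ball [OF segs(1)] Peq by (intro contour_integral_eq) auto
  also have "\<dots> = contour_integral (linepath a b) Qp - contour_integral (linepath a b) Qm"
    using integrable [OF segs(1)] by (intro contour_integral_diff)
  finally have 3: "contour_integral (linepath a b) P = \<dots>" .
  have 4: "contour_integral (linepath q p) P = - contour_integral (linepath p q) P"
  proof (rule contour_integral_reverse_linepath)
    have "closed_segment q p \<subseteq> ball (of_real x0) (2 * \<rho>)"
      using \<rho> by (intro closed_segment_subset) (auto simp: p_def q_def dist_norm convex_ball)
    then show "continuous_on (closed_segment q p) P" by (rule contP)
  qed

  \<comment> \<open>Estimates on the edges of the rectangle\<close>
  have Q: "norm (half_kernel \<sigma> L (z - w) / (z - w) * G w) \<le> V"
    if "\<sigma> = \<i> \<or> \<sigma> = - \<i>" "w \<in> ball (of_real x0) (2 * \<rho>)" "3 * t \<le> norm (z - w)"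
      "- Im (z - w) * Im \<sigma> - (Re (z - w))\<^sup>2 + (Im (z - w))\<^sup>2 \<le> - (\<rho>\<^sup>2 / 16)" for \<sigma> w
  proof -
    have "norm (half_kernel \<sigma> L (z - w)) / norm (z - w) * norm (G w) \<le> exp (- (\<rho>\<^sup>2 / 16) * L) / (3 * t) * A"
      using that L A0 st by (intro mult_mono frac_le A norm_half_kernel_le) auto
    then show ?thesis
      by (simp add: V_def norm_mult norm_divide)
  qed
  have tt: "t\<^sup>2 \<le> t / 32" "\<rho>\<^sup>2 = 32 * t"
    using st by (auto simp: power2_eq_square t_def)
  \<comment> \<open>On the vertical edges |Re (z - w)| is at least 31/32 \<rho>, and the Gaussian
    alone outweighs the growth of either exponential. \<open>P\<close>, being the difference of the
    halves, gets 2 V.\<close>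
  have vert: "norm (Qp w) \<le> V \<and> norm (Qm w) \<le> V \<and> norm (P w) \<le> 2 * V"
    if "w \<in> closed_segment b c \<or> w \<in> closed_segment d a" for w
  proof -
    have wball: "w \<in> ball (of_real x0) (2 * \<rho>)" "w \<noteq> z"
      using that segs path_ac by blast+
    have w: "\<bar>Re w - x0\<bar> = \<rho>" "\<bar>Im w\<bar> \<le> s"
      using that st \<rho>
      by (auto simp: closed_segment_same_Re a_def b_def c_def d_def closed_segment_eq_real_ivl)
    have im: "\<bar>Im (z - w)\<bar> \<le> 5 * t" and re: "31 / 32 * \<rho> \<le> \<bar>Re (z - w)\<bar>"
      using w Re_z Im_z st unfolding minus_complex.sel by linarith+
    have "(Im (z - w))\<^sup>2 \<le> (5 * t)\<^sup>2"
      using power_mono [OF im, of 2] by simp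
    moreover have "(31 / 32 * \<rho>)\<^sup>2 \<le> (Re (z - w))\<^sup>2"
      using power_mono [OF re, of 2] \<rho> by simp
    ultimately have "\<bar>Im (z - w)\<bar> - (Re (z - w))\<^sup>2 + (Im (z - w))\<^sup>2 \<le> - (\<rho>\<^sup>2 / 16)"
      using im(1) tt st unfolding power_mult_distrib power_divide by simp
    then have ex: "- Im (z - w) * Im \<sigma> - (Re (z - w))\<^sup>2 + (Im (z - w))\<^sup>2 \<le> - (\<rho>\<^sup>2 / 16)"
      if "\<sigma> = \<i> \<or> \<sigma> = - \<i>" for \<sigma>
      using that by auto
    have "3 * t \<le> norm (z - w)"
      using re abs_Re_le_cmod [of "z - w"] st by linarith
    then have "norm (Qp w) \<le> V" "norm (Qm w) \<le> V"
      using Q [OF _ wball(1) _ ex] unfolding Qp_def Qm_def by blast+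
    then show ?thesis
      using Peq [OF wball(2)] norm_triangle_ineq4 [of "Qp w" "Qm w"] by simp
  qed
  \<comment> \<open>One statement for both edges: \<sigma> = i is the bottom edge, \<sigma> = -i the
    top one. The linear term contributes at most -3 t and (Im (z - w))^2 at most 25/32 t, together
    below -2 t.\<close>
  have horiz: "norm (half_kernel \<sigma> L (z - w) / (z - w) * G w) \<le> V"
    if \<sigma>: "\<sigma> = \<i> \<or> \<sigma> = - \<i>" and w: "w \<in> path_image (rectpath a c)" "Im w = - s * Im \<sigma>" for w \<sigma>
  proof (rule Q)
    show "w \<in> ball (of_real x0) (2 * \<rho>)"
      using w path_ac by blast
    have im: "3 * t \<le> Im (z - w) * Im \<sigma>" "\<bar>Im (z - w)\<bar> \<le> 5 * t"
      using \<sigma> w(2) Im_z st by auto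
    have "Im (z - w) * Im \<sigma> \<le> \<bar>Im (z - w)\<bar>"
      using \<sigma> by auto
    then show "3 * t \<le> norm (z - w)"
      using im(1) abs_Im_le_cmod [of "z - w"] by linarith
    have "(Im (z - w))\<^sup>2 \<le> (5 * t)\<^sup>2"
      using power_mono [OF im(2), of 2] by simp
    then have "(Im (z - w))\<^sup>2 \<le> 25 * (t / 32)"
      using tt by (simp add: power_mult_distrib)
    moreover have "- Im (z - w) * Im \<sigma> \<le> - (3 * t)"
      using im(1) unfolding mult_minus_left by linarith
    ultimately show "- Im (z - w) * Im \<sigma> - (Re (z - w))\<^sup>2 + (Im (z - w))\<^sup>2 \<le> - (\<rho>\<^sup>2 / 16)"
      using tt(2) st(2) zero_le_power2 [of "Re (z - w)"] by linarith
  qed (fact \<sigma>)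
  have bot: "norm (Qp w) \<le> V" if "w \<in> closed_segment a b" for w
    unfolding Qp_def
  proof (rule horiz)
    show "w \<in> path_image (rectpath a c)" using that segs(1) by (rule rev_subsetD)
    show "Im w = - s * Im \<i>" using that by (simp add: closed_segment_same_Im a_def b_def)
  qed simp
  have top: "norm (Qm w) \<le> V" if "w \<in> closed_segment c d" for w
    unfolding Qm_def
  proof (rule horiz)
    show "w \<in> path_image (rectpath a c)" using that segs(3) by (rule rev_subsetD)
    show "Im w = - s * Im (- \<i>)" using that by (simp add: closed_segment_same_Im c_def d_def)
  qed simp
  have bound: "norm (contour_integral (linepath u v) f) \<le> 2 * V"
    if "f contour_integrable_on linepath u v" "\<And>w. w \<in> closed_segment u v \<Longrightarrow> norm (f w) \<le> B"
      "0 \<le> B" "B * norm (v - u) \<le> 2 * V" for u v f B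
    using contour_integral_bound_linepath [OF that(1,3,2)] that(4) by simp
  have len: "norm (b - a) \<le> 2" "norm (c - b) \<le> 2" "norm (d - c) \<le> 2" "norm (a - d) \<le> 2"
    "norm (q - b) \<le> 1" "norm (a - p) \<le> 1"
    using st \<rho> by (auto intro!: order_trans [OF cmod_le] simp: a_def b_def c_def d_def p_def q_def)
  have integrals:
    "norm (contour_integral (linepath a b) Qp) \<le> 2 * V"
    "norm (contour_integral (linepath b c) Qm) \<le> 2 * V"
    "norm (contour_integral (linepath c d) Qm) \<le> 2 * V"
    "norm (contour_integral (linepath d a) Qm) \<le> 2 * V"
    "norm (contour_integral (linepath b q) P) \<le> 2 * V"
    "norm (contour_integral (linepath p a) P) \<le> 2 * V"
  proof -
    have V2: "V * norm u \<le> 2 * V" if "norm u \<le> 2" for u :: complex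
      using mult_left_mono [OF that V0] by simp
    have V1: "2 * V * norm u \<le> 2 * V" if "norm u \<le> 1" for u :: complex
      using mult_left_mono [OF that, of "2 * V"] V0 by simp
    show "norm (contour_integral (linepath a b) Qp) \<le> 2 * V"
      by (rule bound [OF integrable(1) [OF segs(1)] bot V0 V2 [OF len(1)]])
    show "norm (contour_integral (linepath b c) Qm) \<le> 2 * V"
      using vert by (intro bound [OF integrable(2) [OF segs(2)] _ V0 V2 [OF len(2)]]) blast
    show "norm (contour_integral (linepath c d) Qm) \<le> 2 * V"
      by (rule bound [OF integrable(2) [OF segs(3)] top V0 V2 [OF len(3)]])
    show "norm (contour_integral (linepath d a) Qm) \<le> 2 * V"
      using vert by (intro bound [OF integrable(2) [OF segs(4)] _ V0 V2 [OF len(4)]]) blast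
    have V20: "0 \<le> 2 * V" using V0 by simp
    show "norm (contour_integral (linepath b q) P) \<le> 2 * V"
      using vert sub by (intro bound [OF integrable(3) [OF subset_trans [OF sub(1) segs(2)]] _ V20 V1 [OF len(5)]]) blast
    show "norm (contour_integral (linepath p a) P) \<le> 2 * V"
      using vert sub by (intro bound [OF integrable(3) [OF subset_trans [OF sub(2) segs(4)]] _ V20 V1 [OF len(6)]]) blast
  qed

  \<comment> \<open>Collecting the edge contributions\<close>
  have arith: "i - g = x + m2 + m3 + m4 + bq + pa"
    if "ab + bq + qp + pa = 0" "m1 + m2 + m3 + m4 = - g" "ab = x - m1" "qp = - i"
    for i g x ab bq qp pa m1 m2 m3 m4 :: complex
    using that by algebra
  have "contour_integral (linepath p q) P - G z = contour_integral (linepath a b) Qp +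
      contour_integral (linepath b c) Qm + contour_integral (linepath c d) Qm +
      contour_integral (linepath d a) Qm + contour_integral (linepath b q) P + contour_integral (linepath p a) P"
    using arith 1 2 3 4 by blast
  \<comment> \<open>Six integrals of at most 2 V each; 12 V is the stated bound because
    \<open>V\<close> has the denominator 3 t = 3 \<rho>^2 / 32.\<close>
  also have "norm \<dots> \<le> 2 * V + 2 * V + 2 * V + 2 * V + 2 * V + 2 * V"
    by (intro norm_triangle_le add_mono integrals)
  also have "\<dots> = 128 / \<rho>\<^sup>2 * A * exp (- \<rho>\<^sup>2 / 16 * L)"
    by (simp add: V_def t_def)
  also have "contour_integral (linepath p q) P =
      integral {x0 - \<rho>..x0 + \<rho>} (\<lambda>y. sinc_gauss L (z - of_real y) * G (of_real y))"
    using \<rho> by (subst contour_integral_linepath_Reals_eq) (auto simp: p_def q_def P_def)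
  finally show ?thesis .
qed

section \<open>Convolution of the kernel with continuous functions\<close>

lemma continuous_sinc_gauss: "continuous_on S (\<lambda>y. sinc_gauss L (z - of_real y))"
proof -
  have "continuous_on UNIV (sinc_gauss L)"
    using holomorphic_sinc_gauss by (rule holomorphic_on_imp_continuous_on)
  then show ?thesis
    by (rule continuous_on_compose2) (auto intro!: continuous_intros)
qed

text \<open>Differentiation under the integral sign. Holomorphy in z comes from the kernel alone, so
  \<open>\<phi>\<close> is merely continuous.\<close>

lemma holomorphic_sinc_gauss_convolution:
  fixes \<phi> :: "real \<Rightarrow> complex"
  assumes "continuous_on {a..b} \<phi>"
  shows "(\<lambda>z. integral {a..b} (\<lambda>y. sinc_gauss L (z - of_real y) * \<phi> y)) holomorphic_on UNIV"
proof -
  let ?K = "sinc_gauss L"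
  have "(\<lambda>z. integral (cbox a b) (\<lambda>y. ?K (z - of_real y) * \<phi> y)) holomorphic_on UNIV"
  proof (rule leibniz_rule_holomorphic)
    fix z :: complex and y :: real
    have "(?K has_field_derivative deriv ?K (z - of_real y)) (at (z - of_real y))"
      using holomorphic_sinc_gauss by (rule holomorphic_derivI) auto
    then have "((\<lambda>z. ?K (z - of_real y)) has_field_derivative deriv ?K (z - of_real y)) (at z)"
      using DERIV_shift [of ?K "deriv ?K (z - of_real y)" z "- of_real y"] by simp
    then show "((\<lambda>z. ?K (z - of_real y) * \<phi> y) has_field_derivative deriv ?K (z - of_real y) * \<phi> y) (at z)"
      by (rule DERIV_cmult_right)
  next
    fix z :: complex
    show "(\<lambda>y. ?K (z - of_real y) * \<phi> y) integrable_on cbox a b"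
      using assms by (intro integrable_continuous continuous_intros continuous_sinc_gauss) simp
  next
    have "continuous_on UNIV (deriv ?K)"
      using holomorphic_deriv [OF holomorphic_sinc_gauss] by (intro holomorphic_on_imp_continuous_on) auto
    then have "continuous_on (UNIV \<times> cbox a b) (\<lambda>p. deriv ?K (fst p - of_real (snd p)))"
      by (rule continuous_on_compose2) (auto intro!: continuous_intros)
    moreover have "continuous_on (UNIV \<times> cbox a b) (\<lambda>p. \<phi> (snd p))"
      using assms by (rule continuous_on_compose2) (auto intro!: continuous_intros)
    ultimately show "continuous_on (UNIV \<times> cbox a b) (\<lambda>(z, y). deriv ?K (z - of_real y) * \<phi> y)"
      unfolding case_prod_unfold by (rule continuous_on_mult)
  qed simp
  then show ?thesis by simp
qed

text \<open>The interval is cut at x0 - \<rho> and x0 + \<rho>. The outer pieces are small by the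
  Gaussian. On the middle piece \<open>\<phi>\<close> is replaced by \<open>G\<close>, the error
  \<delta> being amplified by at most exp (2 L), and \<open>G\<close> is then reproduced up to a
  multiple of exp (- \<rho>^2 L / 16).\<close>

lemma sinc_gauss_convolution_approximates:
  fixes x0 \<rho> L A H R \<delta> :: real and z :: complex and G :: "complex \<Rightarrow> complex" and \<phi> :: "real \<Rightarrow> complex"
  assumes \<rho>: "0 < \<rho>" "\<rho> \<le> 1" and L: "1 \<le> L"
    and G: "G holomorphic_on ball (of_real x0) (2 * \<rho>)"
    and A: "\<And>w. w \<in> ball (of_real x0) (2 * \<rho>) \<Longrightarrow> norm (G w) \<le> A"
    and z: "z \<in> ball (of_real x0) (\<rho>\<^sup>2 / 32)"
    and \<phi>: "continuous_on {-R..R} \<phi>" "\<And>y. y \<in> {-R..R} \<Longrightarrow> norm (\<phi> y) \<le> H"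
    and R: "{x0 - \<rho>..x0 + \<rho>} \<subseteq> {-R..R}"
    and \<delta>: "\<And>y. y \<in> {x0 - \<rho>..x0 + \<rho>} \<Longrightarrow> norm (\<phi> y - G (of_real y)) \<le> \<delta>"
  shows "norm (integral {-R..R} (\<lambda>y. sinc_gauss L (z - of_real y) * \<phi> y) - G z)
    \<le> (128 / \<rho>\<^sup>2 * A + 4 / \<rho> * R * H) * exp (- \<rho>\<^sup>2 / 16 * L) + 2 * \<delta> * exp (2 * L)"
proof -
  define t where "t = \<rho>\<^sup>2 / 32"
  have \<rho>2: "\<rho>\<^sup>2 \<le> \<rho>" "0 < \<rho>\<^sup>2"
    using \<rho> by (auto simp: power2_eq_square mult_left_le)
  have t: "0 < t" "t \<le> \<rho> / 32" "t \<le> 1/4" "\<rho>\<^sup>2 = 32 * t" "t\<^sup>2 \<le> t / 32"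
  proof -
    show "0 < t" "t \<le> \<rho> / 32" "t \<le> 1/4" "\<rho>\<^sup>2 = 32 * t"
      using \<rho>2 \<rho> unfolding t_def by linarith+
    have "t \<le> 1/32"
      using \<rho>2 \<rho> unfolding t_def by linarith
    then show "t\<^sup>2 \<le> t / 32"
      using mult_left_mono [of t "1/32" t] \<open>0 < t\<close> by (simp add: power2_eq_square)
  qed
  let ?K = "\<lambda>y. sinc_gauss L (z - of_real y)"
  let ?I = "\<lambda>S. integral S (\<lambda>y. ?K y * \<phi> y)"
  have Re_z: "\<bar>Re z - x0\<bar> < t" and Im_z: "\<bar>Im z\<bar> < t"
    using z abs_Re_le_cmod [of "z - of_real x0"] abs_Im_le_cmod [of "z - of_real x0"]
    by (auto simp: t_def dist_norm norm_minus_commute)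
  have R': "- R \<le> x0 - \<rho>" "x0 + \<rho> \<le> R" "0 \<le> R" "x0 - \<rho> \<in> {-R..R}" "x0 \<in> {x0-\<rho>..x0+\<rho>}"
    using R \<rho> by auto
  have H0: "0 \<le> H" and \<delta>0: "0 \<le> \<delta>"
    using \<phi>(2) [OF R'(4)] \<delta> [OF R'(5)] norm_ge_zero order_trans by blast+
  have integrable: "(\<lambda>y. ?K y * \<phi> y) integrable_on {-R..R}"
    using \<phi> by (intro integrable_continuous_real continuous_intros continuous_sinc_gauss)
  have split: "?I {-R..R} = ?I {-R..x0 - \<rho>} + ?I {x0 - \<rho>..x0 + \<rho>} + ?I {x0 + \<rho>..R}"
  proof -
    have "?I {-R..R} = ?I {-R..x0 - \<rho>} + ?I {x0 - \<rho>..R}"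
      using R' \<rho> integrable by (intro Henstock_Kurzweil_Integration.integral_combine [symmetric]) auto
    moreover have "?I {x0 - \<rho>..R} = ?I {x0 - \<rho>..x0 + \<rho>} + ?I {x0 + \<rho>..R}"
      using R' \<rho> integrable_subinterval_real [OF integrable, of "x0 - \<rho>" R]
      by (intro Henstock_Kurzweil_Integration.integral_combine [symmetric]) auto
    ultimately show ?thesis by simp
  qed
  let ?e = "exp (- \<rho>\<^sup>2 / 16 * L)"
  \<comment> \<open>Since |Re (z - y)| is at least 31/32 \<rho>, the Gaussian beats the growth exp
    (L (t + t^2)), and 1 / |z - y| is at most 2 / \<rho>.\<close>
  have far: "norm (?K y * \<phi> y) \<le> 2 / \<rho> * ?e * H" if "y \<in> {-R..R}" "\<rho> \<le> \<bar>y - x0\<bar>" for y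
  proof -
    let ?u = "z - of_real y"
    have re: "31 / 32 * \<rho> \<le> \<bar>Re ?u\<bar>"
      using that(2) Re_z t unfolding minus_complex.sel Re_complex_of_real by linarith
    have "(31 / 32 * \<rho>)\<^sup>2 \<le> (Re ?u)\<^sup>2"
      using power_mono [OF re, of 2] \<rho> by simp
    then have "t + t\<^sup>2 - (Re ?u)\<^sup>2 \<le> - \<rho>\<^sup>2 / 16"
      using t unfolding power_mult_distrib power_divide by simp
    then have "L * (t + t\<^sup>2 - (Re ?u)\<^sup>2) \<le> L * (- \<rho>\<^sup>2 / 16)"
      using L by (intro mult_left_mono) auto
    then have ex: "exp (L * (t + t\<^sup>2 - (Re ?u)\<^sup>2)) \<le> ?e"
      by (simp add: mult.commute)
    have norm_u: "\<rho> / 2 \<le> norm ?u"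
      using re abs_Re_le_cmod [of ?u] \<rho> by linarith
    then have "?u \<noteq> 0" using \<rho> by auto
    then have "norm (?K y) \<le> exp (L * (t + t\<^sup>2 - (Re ?u)\<^sup>2)) / norm ?u"
      using L Im_z t by (intro norm_sinc_gauss_le) auto
    also have "\<dots> \<le> ?e / (\<rho> / 2)"
      using ex norm_u \<rho> by (intro frac_le) auto
    finally have "norm (?K y) \<le> 2 / \<rho> * ?e" by (simp add: mult.commute)
    then show ?thesis
      unfolding norm_mult using \<phi>(2) [OF that(1)] \<rho> by (intro mult_mono) auto
  qed
  define k where "k = 2 / \<rho> * ?e * H"
  have "norm (?I {-R..x0 - \<rho>}) \<le> k * (x0 - \<rho> - - R)"
  proof (rule integral_bound)
    show "continuous_on {-R..x0 - \<rho>} (\<lambda>y. ?K y * \<phi> y)"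
      using R' \<rho> by (intro continuous_intros continuous_sinc_gauss continuous_on_subset [OF \<phi>(1)]) auto
  qed (use R' \<rho> far in \<open>auto simp: k_def\<close>)
  moreover have "norm (?I {x0 + \<rho>..R}) \<le> k * (R - (x0 + \<rho>))"
  proof (rule integral_bound)
    show "continuous_on {x0 + \<rho>..R} (\<lambda>y. ?K y * \<phi> y)"
      using R' \<rho> by (intro continuous_intros continuous_sinc_gauss continuous_on_subset [OF \<phi>(1)]) auto
  qed (use R' \<rho> far in \<open>auto simp: k_def\<close>)
  ultimately have "norm (?I {-R..x0 - \<rho>}) + norm (?I {x0 + \<rho>..R}) \<le> k * (2 * R) - k * (2 * \<rho>)"
    by (simp add: algebra_simps)
  also have "\<dots> \<le> k * (2 * R)"
    using \<rho> H0 by (simp add: k_def)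
  finally have outer: "norm (?I {-R..x0 - \<rho>}) + norm (?I {x0 + \<rho>..R}) \<le> 4 / \<rho> * R * H * ?e"
    by (simp add: k_def mult_ac)
  have contG: "continuous_on {x0 - \<rho>..x0 + \<rho>} (\<lambda>y. G (of_real y))"
  proof (rule continuous_on_compose2 [OF holomorphic_on_imp_continuous_on [OF G]])
    show "of_real ` {x0 - \<rho>..x0 + \<rho>} \<subseteq> ball (complex_of_real x0) (2 * \<rho>)"
      using \<rho> by (auto simp: dist_norm simp flip: of_real_diff)
  qed (intro continuous_intros)
  have cont\<phi>: "continuous_on {x0 - \<rho>..x0 + \<rho>} \<phi>"
    using \<phi>(1) R by (rule continuous_on_subset)
  have "norm (?K y * (\<phi> y - G (of_real y))) \<le> exp (2 * L) * \<delta>" if "y \<in> {x0 - \<rho>..x0 + \<rho>}" for y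
    unfolding norm_mult using L Im_z t that
    by (intro mult_mono \<delta> norm_sinc_gauss_le [where t = t]) auto
  then have "norm (integral {x0 - \<rho>..x0 + \<rho>} (\<lambda>y. ?K y * (\<phi> y - G (of_real y)))) \<le>
      exp (2 * L) * \<delta> * (x0 + \<rho> - (x0 - \<rho>))"
    using \<rho> contG cont\<phi> by (intro integral_bound continuous_intros continuous_sinc_gauss) auto
  also have "\<dots> = exp (2 * L) * \<delta> * 2 * \<rho>"
    by simp
  also have "\<dots> \<le> exp (2 * L) * \<delta> * 2 * 1"
    using \<rho> \<delta>0 by (intro mult_left_mono) auto
  also have "integral {x0 - \<rho>..x0 + \<rho>} (\<lambda>y. ?K y * (\<phi> y - G (of_real y))) =
      ?I {x0 - \<rho>..x0 + \<rho>} - integral {x0 - \<rho>..x0 + \<rho>} (\<lambda>y. ?K y * G (of_real y))"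
    unfolding right_diff_distrib using contG cont\<phi>
    by (intro Henstock_Kurzweil_Integration.integral_diff integrable_continuous_real
        continuous_intros continuous_sinc_gauss)
  finally have inner: "norm (?I {x0 - \<rho>..x0 + \<rho>} - integral {x0 - \<rho>..x0 + \<rho>} (\<lambda>y. ?K y * G (of_real y)))
      \<le> 2 * \<delta> * exp (2 * L)"
    by (simp add: mult_ac)
  have main: "norm (integral {x0 - \<rho>..x0 + \<rho>} (\<lambda>y. ?K y * G (of_real y)) - G z) \<le> 128 / \<rho>\<^sup>2 * A * ?e"
    using L by (intro sinc_gauss_reproduces \<rho> G A z) auto
  let ?M = "integral {x0 - \<rho>..x0 + \<rho>} (\<lambda>y. ?K y * G (of_real y))"
  \<comment> \<open>\<open>m\<close> stands for the integral of the kernel against \<open>G\<close>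
    over the middle piece, inserted between the middle integral \<open>q\<close> and the value
    \<open>g\<close>.\<close>
  have triangle: "norm (p + q + r - g) \<le> norm p + norm r + norm (q - m) + norm (m - g)" for p q r m g :: complex
    using norm_triangle_ineq [of "p + r" "(q - m) + (m - g)"] norm_triangle_ineq [of p r]
      norm_triangle_ineq [of "q - m" "m - g"] by (simp add: algebra_simps)
  have "norm (?I {-R..R} - G z) \<le> 4 / \<rho> * R * H * ?e + 2 * \<delta> * exp (2 * L) + 128 / \<rho>\<^sup>2 * A * ?e"
    using triangle [of "?I {-R..x0 - \<rho>}" "?I {x0 - \<rho>..x0 + \<rho>}" "?I {x0 + \<rho>..R}" "G z" ?M]
      outer inner main unfolding split by linarith
  then show ?thesis
    by (simp add: distrib_right)
qed

section \<open>Analyticity on the real line and in the complex plane\<close>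

text \<open>Induction on n: since \<open>T\<close> is open, agreement of the n-th derivatives on
  \<open>T\<close> passes to the next ones. This makes complex estimates available for the iterated
  real derivatives.\<close>

lemma nth_vderiv_of_real:
  assumes H: "H holomorphic_on S" "open S" and T: "open T" "of_real ` T \<subseteq> S"
    and f: "\<And>x. x \<in> T \<Longrightarrow> f x = H (of_real x)"
  shows smooth_on_of_real: "smooth_on T f"
    and nth_vderiv_of_real_eq: "x \<in> T \<Longrightarrow> nth_vderiv n f x = (deriv ^^ n) H (of_real x)"
proof -
  have step: "(nth_vderiv n f has_vector_derivative (deriv ^^ Suc n) H (of_real x)) (at x)"
    if "x \<in> T" and eq: "\<And>y. y \<in> T \<Longrightarrow> nth_vderiv n f y = (deriv ^^ n) H (of_real y)" for n x
  proof -
    have "((deriv ^^ n) H has_field_derivative (deriv ^^ Suc n) H (of_real x)) (at (of_real x))"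
      using holomorphic_derivI [OF holomorphic_higher_deriv [OF H] H(2)] that T by auto
    then have "((\<lambda>y. (deriv ^^ n) H (of_real y)) has_vector_derivative (deriv ^^ Suc n) H (of_real x)) (at x)"
      by (rule has_vector_derivative_real_field)
    from has_vector_derivative_transform_within_open [OF this T(1) that(1)]
    show ?thesis using eq by simp
  qed
  have eq: "\<forall>x\<in>T. nth_vderiv n f x = (deriv ^^ n) H (of_real x)" for n
  proof (induction n)
    case 0
    then show ?case using f by simp
  next
    case (Suc n)
    then show ?case
      using step [of _ n] by (auto simp: nth_vderiv_Suc simp del: funpow.simps intro!: vector_derivative_at)
  qed
  then show "x \<in> T \<Longrightarrow> nth_vderiv n f x = (deriv ^^ n) H (of_real x)"
    by blast
  show "smooth_on T f"
    unfolding smooth_on_def using step eq by (meson differentiableI_vector)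
qed

text \<open>Cauchy's inequality on circles of radius t / 2 centred in the half ball, which stay
  inside the ball of radius t; hence the ratio 2 / t.\<close>

lemma norm_nth_vderiv_of_real_le:
  assumes H: "H holomorphic_on ball (of_real x0) t" and t: "0 < t"
    and B: "\<And>z. z \<in> ball (of_real x0) t \<Longrightarrow> norm (H z) \<le> B"
    and f: "\<And>x. x \<in> ball x0 t \<Longrightarrow> f x = H (of_real x)"
    and x: "x \<in> ball x0 (t / 2)"
  shows "norm (nth_vderiv n f x) \<le> fact n * B * (2 / t) ^ n"
proof -
  have "nth_vderiv n f x = (deriv ^^ n) H (of_real x)"
    using x t by (intro nth_vderiv_of_real_eq [OF H open_ball, of "ball x0 t"] f)
      (auto simp: dist_norm simp flip: of_real_diff)
  moreover have "cball (of_real x) (t / 2) \<subseteq> ball (complex_of_real x0) t"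
    using x by (auto simp: cball_subset_ball_iff dist_norm abs_minus_commute simp flip: of_real_diff)
  then have "norm ((deriv ^^ n) H (of_real x)) \<le> fact n * B / (t / 2) ^ n"
    using t by (intro Cauchy_inequality)
      (auto intro!: B holomorphic_on_subset [OF H] holomorphic_on_imp_continuous_on simp: subset_iff dist_norm)
  ultimately show ?thesis
    by (simp add: power_divide field_simps)
qed

lemma real_analytic_on_of_real:
  assumes H: "H holomorphic_on UNIV" and "open \<omega>"
  shows "real_analytic_on \<omega> (\<lambda>x. H (of_real x))"
  unfolding real_analytic_on_def
proof (intro ballI)
  fix x0 assume "x0 \<in> \<omega>"
  then obtain r where "r > 0" "ball x0 r \<subseteq> \<omega>"
    using \<open>open \<omega>\<close> open_contains_ball by blast
  moreover have "(\<lambda>n. (deriv ^^ n) H (of_real x0) / fact n * of_real (x - x0) ^ n) sums H (of_real x)"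
    if "x \<in> ball x0 r" for x
  proof -
    have "H holomorphic_on ball (of_real x0) r"
      using H by (rule holomorphic_on_subset) simp
    moreover have "of_real x \<in> ball (complex_of_real x0) r"
      using that by (simp add: dist_norm flip: of_real_diff)
    ultimately show ?thesis
      by (subst of_real_diff) (rule holomorphic_power_series)
  qed
  ultimately show "\<exists>r>0. \<exists>c :: nat \<Rightarrow> complex.
      ball x0 r \<subseteq> \<omega> \<and> (\<forall>x\<in>ball x0 r. (\<lambda>n. c n * of_real (x - x0) ^ n) sums H (of_real x))"
    by (intro exI [of _ r] exI [of _ "\<lambda>n. (deriv ^^ n) H (of_real x0) / fact n"] conjI ballI)
qed

text \<open>\<open>G\<close> is the Taylor series of \<open>g\<close> at \<open>x0\<close>. By r
  \<eta> \<le> 1/2 its terms are dominated by \<eta> A 2^(-n), whence convergence on the complex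
  disc and the bound 2 \<eta> A. It represents \<open>g\<close> on the real ball because the Taylor
  remainder vanishes, all derivatives being controlled on the whole ball.\<close>

lemma holomorphic_extension_of_smooth:
  fixes g :: "real \<Rightarrow> complex"
  assumes g: "smooth_on (ball x0 r) g" and r: "0 < r" and \<eta>: "0 < \<eta>" "r * \<eta> \<le> 1/2"
    and bound: "\<And>n x. x \<in> ball x0 r \<Longrightarrow> norm (nth_vderiv n g x) \<le> \<eta> ^ (n + 1) * fact n * A"
  obtains G where "G holomorphic_on ball (of_real x0) r"
    "\<And>z. z \<in> ball (of_real x0) r \<Longrightarrow> norm (G z) \<le> 2 * \<eta> * A"
    "\<And>x. x \<in> ball x0 r \<Longrightarrow> G (of_real x) = g x"
proof -
  define a where "a n = nth_vderiv n g x0 / fact n" for n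
  define G where "G z = (\<Sum>n. a n * (z - of_real x0) ^ n)" for z :: complex
  have small: "\<eta> * d < 1/2" if "d < r" for d
    using mult_strict_left_mono [OF that \<eta>(1)] \<eta>(2) by (simp add: mult.commute)
  have A0: "0 \<le> \<eta> * A"
    using bound [of x0 0] r norm_ge_zero [of "nth_vderiv 0 g x0"] by (simp del: norm_ge_zero)
  have term_le: "norm (a n * w ^ n) \<le> \<eta> * A * (1/2) ^ n" if "norm w < r" for n w
  proof -
    have "norm (nth_vderiv n g x0) \<le> \<eta> ^ (n + 1) * fact n * A"
      using r by (intro bound) simp
    then have "norm (a n) \<le> \<eta> ^ (n + 1) * A"
      by (simp add: a_def norm_divide divide_le_eq mult_ac)
    then have "norm (a n * w ^ n) \<le> \<eta> ^ (n + 1) * A * norm w ^ n"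
      unfolding norm_mult norm_power by (intro mult_right_mono) auto
    also have "\<dots> = \<eta> * A * (\<eta> * norm w) ^ n"
      by (simp add: power_mult_distrib)
    also have "\<dots> \<le> \<eta> * A * (1/2) ^ n"
    proof (rule mult_left_mono)
      show "(\<eta> * norm w) ^ n \<le> (1/2) ^ n"
        using small [OF that] \<eta> by (intro power_mono) auto
    qed (fact A0)
    finally show ?thesis .
  qed
  have geometric: "(\<lambda>n. \<eta> * A * (1/2) ^ n) sums (2 * \<eta> * A)"
    using sums_mult [OF geometric_sums [of "1/2 :: real"], of "\<eta> * A"] by (simp add: mult_ac)
  have summable: "summable (\<lambda>n. a n * w ^ n)" if "norm w < r" for w
    using term_le [OF that] geometric by (intro summable_comparison_test' [OF sums_summable]) auto
  show ?thesis
  proof (rule that)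
    show "G holomorphic_on ball (of_real x0) r"
      unfolding G_def
      by (rule power_series_holomorphic [where a = a], rule summable_sums, rule summable)
         (simp add: dist_norm norm_minus_commute)
    show "norm (G z) \<le> 2 * \<eta> * A" if "z \<in> ball (of_real x0) r" for z
    proof -
      have z: "norm (z - of_real x0) < r"
        using that by (simp add: dist_norm norm_minus_commute)
      have "norm (G z) \<le> (\<Sum>n. \<eta> * A * (1/2) ^ n)"
        unfolding G_def by (rule norm_suminf_le [OF term_le [OF z] sums_summable [OF geometric]])
      then show ?thesis
        using sums_unique [OF geometric] by simp
    qed
    show "G (of_real x) = g x" if x: "x \<in> ball x0 r" for x
    proof -
      define d where "d = x - x0"
      have d: "\<bar>d\<bar> < r"
        using x by (simp add: d_def dist_real_def abs_minus_commute)
      \<comment> \<open>\<open>Df m\<close> is the m-th derivative of g (x0 + s d) in s; rescaling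
        to the unit interval treats both signs of \<open>d\<close> at once.\<close>
      define Df where "Df m s = d ^ m *\<^sub>R nth_vderiv m g (x0 + s * d)" for m s
      have seg: "x0 + s * d \<in> ball x0 r" if "s \<in> {0..1}" for s
      proof -
        have "\<bar>s * d\<bar> \<le> \<bar>d\<bar>"
          using that by (simp add: abs_mult mult_left_le_one_le)
        then show ?thesis using d by (simp add: dist_real_def)
      qed
      have deriv: "(Df m has_vector_derivative Df (Suc m) s) (at s within {0..1})" if "s \<in> {0..1}" for m s
      proof -
        have "((\<lambda>s. x0 + s * d) has_vector_derivative d) (at s within {0..1})"
          by (auto intro!: derivative_eq_intros)
        moreover have "(nth_vderiv m g has_vector_derivative nth_vderiv (Suc m) g (x0 + s * d))
            (at (x0 + s * d) within (\<lambda>s. x0 + s * d) ` {0..1})"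
          using smooth_on_has_vector_derivative [OF g seg [OF that]] has_vector_derivative_at_within by blast
        ultimately have "(nth_vderiv m g \<circ> (\<lambda>s. x0 + s * d) has_vector_derivative
            d *\<^sub>R nth_vderiv (Suc m) g (x0 + s * d)) (at s within {0..1})"
          by (rule vector_diff_chain_within)
        then show ?thesis
          unfolding Df_def o_def
          by (auto intro!: derivative_eq_intros elim!: has_vector_derivative_eq_rhs simp: mult.commute)
      qed
      \<comment> \<open>Taylor's formula with integral remainder. The factor n is the quotient of
        the factorials of n and n - 1, harmless since \<eta> |d| < 1/2.\<close>
      have bound_n: "norm (g x - (\<Sum>i<n. a i * of_real d ^ i)) \<le> real n * (\<eta> * \<bar>d\<bar>) ^ n * (\<eta> * A)"
        if "0 < n" for n
      proof -
        have "((\<lambda>s. ((1 - s) ^ (n - 1) / fact (n - 1)) *\<^sub>R Df n s) has_integral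
            Df 0 1 - (\<Sum>i<n. ((1 - 0) ^ i / fact i) *\<^sub>R Df i 0)) {0..1}"
          using that deriv by (intro Taylor_has_integral) auto
        moreover have "Df 0 1 - (\<Sum>i<n. ((1 - 0) ^ i / fact i) *\<^sub>R Df i 0) = g x - (\<Sum>i<n. a i * of_real d ^ i)"
          by (simp add: Df_def a_def d_def scaleR_conv_of_real mult.commute)
        moreover have "norm (((1 - s) ^ (n - 1) / fact (n - 1)) *\<^sub>R Df n s) \<le> real n * (\<eta> * \<bar>d\<bar>) ^ n * (\<eta> * A)"
          if s: "s \<in> cbox 0 1" for s
        proof -
          have "norm (((1 - s) ^ (n - 1) / fact (n - 1)) *\<^sub>R Df n s) =
              (1 - s) ^ (n - 1) / fact (n - 1) * (\<bar>d\<bar> ^ n * norm (nth_vderiv n g (x0 + s * d)))"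
            using s by (simp add: Df_def abs_mult power_abs)
          also have "\<dots> \<le> 1 / fact (n - 1) * (\<bar>d\<bar> ^ n * (\<eta> ^ (n + 1) * fact n * A))"
            using s by (intro mult_mono divide_right_mono power_le_one mult_left_mono bound seg) auto
          also have "\<dots> = real n * (\<eta> * \<bar>d\<bar>) ^ n * (\<eta> * A)"
            using \<open>0 < n\<close> by (simp add: fact_reduce [of n] power_mult_distrib)
          finally show ?thesis .
        qed
        moreover have "0 \<le> real n * (\<eta> * \<bar>d\<bar>) ^ n * (\<eta> * A)"
          using \<eta> by (intro mult_nonneg_nonneg [OF _ A0]) simp
        ultimately have "norm (g x - (\<Sum>i<n. a i * of_real d ^ i)) \<le>
            real n * (\<eta> * \<bar>d\<bar>) ^ n * (\<eta> * A) * measure lborel (cbox 0 (1::real))"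
          by (intro has_integral_bound [where f = "\<lambda>s. ((1 - s) ^ (n - 1) / fact (n - 1)) *\<^sub>R Df n s"]) auto
        then show ?thesis by simp
      qed
      have "(\<lambda>n. g x - (\<Sum>i<n. a i * of_real d ^ i)) \<longlonglongrightarrow> 0"
      proof (rule Lim_null_comparison)
        show "\<forall>\<^sub>F n in sequentially. norm (g x - (\<Sum>i<n. a i * of_real d ^ i)) \<le>
            real n * (\<eta> * \<bar>d\<bar>) ^ n * (\<eta> * A)"
          using bound_n eventually_gt_at_top [of 0] by (rule eventually_mono [rotated])
        show "(\<lambda>n. real n * (\<eta> * \<bar>d\<bar>) ^ n * (\<eta> * A)) \<longlonglongrightarrow> 0"
          using small [OF d] \<eta> by (intro tendsto_mult_left_zero powser_times_n_limit_0) auto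
      qed
      then have "(\<lambda>i. a i * of_real d ^ i) sums g x"
        using tendsto_diff [OF tendsto_const [of "g x"]] by (fastforce simp: sums_def)
      then show "G (of_real x) = g x"
        by (simp add: G_def d_def sums_iff)
    qed
  qed
qed

text \<open>With L = l ln (1 / \<epsilon>) every exponential is a power: exp (s L) = \<epsilon>^(- s
  l). The choice l = k (1 + A) gives c l - 1 - A = (c k - 1) (1 + A) \<ge> b, which beats the growth
  of interval and integrand; the last term has exponent 3 l - 2 l = l \<ge> b.\<close>

lemma convolution_error_negligible:
  fixes \<epsilon> a b c k l A p q :: real
  assumes "\<epsilon> \<in> {0<..<1}" and "0 < c" "0 \<le> A" "0 \<le> p" "0 \<le> q"
    and k: "0 \<le> k" "a + b \<le> c * k" "1 + b \<le> c * k" "1 \<le> c * k" "b \<le> k"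
    and l: "l = k * (1 + A)"
  shows "(p * \<epsilon> powr (-a) + q * \<epsilon> powr (-1) * \<epsilon> powr (-A)) * exp (- c * (l * ln (1 / \<epsilon>))) +
      2 * \<epsilon> powr (3 * l) * exp (2 * (l * ln (1 / \<epsilon>))) \<le> (p + q + 2) * \<epsilon> powr b"
proof -
  have \<epsilon>: "0 < \<epsilon>" "\<epsilon> < 1" using assms(1) by auto
  have exp_eq: "exp (s * (l * ln (1 / \<epsilon>))) = \<epsilon> powr (- s * l)" for s
    using \<epsilon> by (simp add: powr_def ln_div)
  have mono: "\<epsilon> powr x \<le> \<epsilon> powr y" if "y \<le> x" for x y
    using \<epsilon> that by (intro powr_mono') auto
  have kl: "k \<le> l"
    using k(1) assms(3) by (simp add: l algebra_simps)
  have ckl: "c * k \<le> c * l"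
    using kl assms(2) by (intro mult_left_mono) auto
  have "b \<le> (c * k - 1) * 1"
    using k by simp
  also have "\<dots> \<le> (c * k - 1) * (1 + A)"
    using k assms(3) by (intro mult_left_mono) auto
  also have "\<dots> = c * l - 1 - A"
    by (simp add: l algebra_simps)
  finally have *: "b \<le> - 1 + - A + c * l" by simp
  have "(p * \<epsilon> powr (-a) + q * \<epsilon> powr (-1) * \<epsilon> powr (-A)) * exp (- c * (l * ln (1 / \<epsilon>))) +
      2 * \<epsilon> powr (3 * l) * exp (2 * (l * ln (1 / \<epsilon>))) =
      p * \<epsilon> powr (- a + c * l) + q * \<epsilon> powr (- 1 + - A + c * l) + 2 * \<epsilon> powr l"
    unfolding exp_eq distrib_right mult.assoc powr_add [symmetric] by simp
  also have "\<dots> \<le> p * \<epsilon> powr b + q * \<epsilon> powr b + 2 * \<epsilon> powr b"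
    using assms(4,5) k kl ckl * by (intro add_mono mult_left_mono mono) auto
  finally show ?thesis
    by (simp add: distrib_right)
qed

text \<open>At one fixed \<epsilon>, \<open>g\<close> extends to a holomorphic \<open>G\<close>, the
  convolution is compared with \<open>G\<close> on a disc of radius \<rho>^2 / 32, and Cauchy's
  estimates on half that radius give both bounds. Large b serve negligibility of the difference from
  \<open>g\<close>; -a \<le> b lets the convolution inherit the growth of \<open>G\<close>.
  \<open>M\<close> adds the coefficients of the three error terms.\<close>

lemma sinc_gauss_convolution_derivatives:
  fixes x0 \<rho> \<eta> \<epsilon> a b k l A R :: real and g f \<phi> :: "real \<Rightarrow> complex"
  assumes \<rho>: "0 < \<rho>" "\<rho> \<le> 1" and \<eta>: "0 < \<eta>" "4 * \<rho> * \<eta> \<le> 1"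
    and g: "smooth_on (ball x0 (2 * \<rho>)) g"
      "\<And>n x. x \<in> ball x0 (2 * \<rho>) \<Longrightarrow> norm (nth_vderiv n g x) \<le> \<eta> ^ (n + 1) * fact n * \<epsilon> powr (- a)"
    and \<epsilon>: "\<epsilon> \<in> {0<..<1}" and A: "0 \<le> A" and ab: "- a \<le> b"
    and k: "0 \<le> k" "a + b \<le> \<rho>\<^sup>2 / 16 * k" "1 + b \<le> \<rho>\<^sup>2 / 16 * k" "1 \<le> \<rho>\<^sup>2 / 16 * k" "b \<le> k"
    and l: "l = k * (1 + A)" "1 \<le> l * ln (1 / \<epsilon>)"
    and \<phi>: "continuous_on {-R..R} \<phi>" "\<And>y. y \<in> {-R..R} \<Longrightarrow> norm (\<phi> y) \<le> \<epsilon> powr (- A)"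
    and R: "{x0 - \<rho>..x0 + \<rho>} \<subseteq> {-R..R}" "R \<le> \<epsilon> powr (-1)"
    and near: "\<And>y. y \<in> {x0 - \<rho>..x0 + \<rho>} \<Longrightarrow> norm (\<phi> y - g y) \<le> \<epsilon> powr (3 * l)"
    and f: "\<And>x. f x = integral {-R..R} (\<lambda>y. sinc_gauss (l * ln (1 / \<epsilon>)) (of_real x - of_real y) * \<phi> y)"
    and x: "x \<in> ball x0 (\<rho>\<^sup>2 / 64)"
  defines "M \<equiv> 256 * \<eta> / \<rho>\<^sup>2 + 4 / \<rho> + 2"
  shows "norm (nth_vderiv n (\<lambda>y. f y - g y) x) \<le> fact n * (M * \<epsilon> powr b) * (64 / \<rho>\<^sup>2) ^ n"
    and "norm (nth_vderiv n f x) \<le> fact n * ((2 * \<eta> + M) * \<epsilon> powr (- a)) * (64 / \<rho>\<^sup>2) ^ n"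
proof -
  define L where "L = l * ln (1 / \<epsilon>)"
  define t where "t = \<rho>\<^sup>2 / 32"
  define F where "F z = integral {-R..R} (\<lambda>y. sinc_gauss L (z - of_real y) * \<phi> y)" for z
  have fF: "f x = F (of_real x)" for x
    by (simp add: f F_def L_def)
  have F: "F holomorphic_on UNIV"
    unfolding F_def using \<phi>(1) by (rule holomorphic_sinc_gauss_convolution)
  have "\<rho>\<^sup>2 \<le> \<rho>"
    using \<rho> by (simp add: power2_eq_square mult_left_le)
  then have t: "0 < t" "t \<le> 2 * \<rho>"
    using \<rho> by (auto simp: t_def)
  \<comment> \<open>The hypothesis 4 \<rho> \<eta> \<le> 1 is the convergence condition r \<eta>
    \<le> 1/2 for the radius r = 2 \<rho>.\<close>
  obtain G where G: "G holomorphic_on ball (of_real x0) (2 * \<rho>)"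
    "\<And>z. z \<in> ball (of_real x0) (2 * \<rho>) \<Longrightarrow> norm (G z) \<le> 2 * \<eta> * \<epsilon> powr (- a)"
    "\<And>x. x \<in> ball x0 (2 * \<rho>) \<Longrightarrow> G (of_real x) = g x"
    using holomorphic_extension_of_smooth [OF g(1) _ \<eta>(1) _ g(2)] \<rho> \<eta>(2) by (auto simp: mult_ac)
  have M0: "0 < M"
    using \<rho> \<eta> by (simp add: M_def add_pos_pos)
  have FG: "norm (F z - G z) \<le> M * \<epsilon> powr b" if z: "z \<in> ball (of_real x0) t" for z
  proof -
    have "norm (F z - G z) \<le> (128 / \<rho>\<^sup>2 * (2 * \<eta> * \<epsilon> powr (- a)) + 4 / \<rho> * R * \<epsilon> powr (- A)) *
        exp (- \<rho>\<^sup>2 / 16 * L) + 2 * \<epsilon> powr (3 * l) * exp (2 * L)"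
      unfolding F_def
    proof (rule sinc_gauss_convolution_approximates [OF \<rho> _ G(1,2) _ \<phi> R(1)])
      show "1 \<le> L" using l(2) by (simp add: L_def)
      show "z \<in> ball (of_real x0) (\<rho>\<^sup>2 / 32)" using z by (simp add: t_def)
      show "norm (\<phi> y - G (of_real y)) \<le> \<epsilon> powr (3 * l)" if "y \<in> {x0 - \<rho>..x0 + \<rho>}" for y
      proof -
        have "G (of_real y) = g y"
          using that \<rho> by (intro G(3)) (auto simp: dist_real_def)
        then show ?thesis using near [OF that] by simp
      qed
    qed
    also have "\<dots> \<le> (256 * \<eta> / \<rho>\<^sup>2 * \<epsilon> powr (- a) + 4 / \<rho> * \<epsilon> powr (-1) * \<epsilon> powr (- A)) *
        exp (- (\<rho>\<^sup>2 / 16) * L) + 2 * \<epsilon> powr (3 * l) * exp (2 * L)"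
    proof -
      have "4 / \<rho> * R * \<epsilon> powr (- A) \<le> 4 / \<rho> * \<epsilon> powr (-1) * \<epsilon> powr (- A)"
        using \<rho> by (intro mult_right_mono mult_left_mono R(2)) auto
      then have "(128 / \<rho>\<^sup>2 * (2 * \<eta> * \<epsilon> powr (- a)) + 4 / \<rho> * R * \<epsilon> powr (- A)) * exp (- (\<rho>\<^sup>2 / 16) * L) \<le>
          (256 * \<eta> / \<rho>\<^sup>2 * \<epsilon> powr (- a) + 4 / \<rho> * \<epsilon> powr (-1) * \<epsilon> powr (- A)) * exp (- (\<rho>\<^sup>2 / 16) * L)"
        by (intro mult_right_mono [OF add_mono]) auto
      then show ?thesis by (simp only: minus_divide_left add_right_mono)
    qed
    also have "\<dots> \<le> M * \<epsilon> powr b"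
      unfolding M_def L_def using \<rho> \<eta>
      by (intro convolution_error_negligible [OF \<epsilon> _ A _ _ k l(1)]) auto
    finally show ?thesis .
  qed
  have sub: "ball (of_real x0) t \<subseteq> ball (complex_of_real x0) (2 * \<rho>)" "ball x0 t \<subseteq> ball x0 (2 * \<rho>)"
    using t by auto
  have x': "x \<in> ball x0 (t / 2)" using x by (simp add: t_def)
  have t_inv: "2 / t = 64 / \<rho>\<^sup>2" by (simp add: t_def)
  have "norm (nth_vderiv n (\<lambda>y. f y - g y) x) \<le> fact n * (M * \<epsilon> powr b) * (2 / t) ^ n"
  proof (rule norm_nth_vderiv_of_real_le [OF _ t(1) FG _ x'])
    show "(\<lambda>z. F z - G z) holomorphic_on ball (of_real x0) t"
      using F G(1) sub(1) by (intro holomorphic_intros) (auto elim: holomorphic_on_subset)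
    show "f y - g y = F (of_real y) - G (of_real y)" if "y \<in> ball x0 t" for y
      using that sub(2) G(3) [of y] fF by auto
  qed
  then show "norm (nth_vderiv n (\<lambda>y. f y - g y) x) \<le> fact n * (M * \<epsilon> powr b) * (64 / \<rho>\<^sup>2) ^ n"
    by (simp only: t_inv)
  have "norm (F z) \<le> (2 * \<eta> + M) * \<epsilon> powr (- a)" if z: "z \<in> ball (of_real x0) t" for z
  proof -
    have "norm (F z) \<le> norm (G z) + norm (F z - G z)"
      using norm_triangle_ineq [of "G z" "F z - G z"] by simp
    also have "\<dots> \<le> 2 * \<eta> * \<epsilon> powr (- a) + M * \<epsilon> powr b"
      using z sub(1) FG G(2) by (intro add_mono) auto
    also have "\<epsilon> powr b \<le> \<epsilon> powr (- a)"
      using \<epsilon> ab by (intro powr_mono') auto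
    finally show ?thesis
      using M0 by (simp add: distrib_right)
  qed
  then have "norm (nth_vderiv n f x) \<le> fact n * ((2 * \<eta> + M) * \<epsilon> powr (- a)) * (2 / t) ^ n"
    by (rule norm_nth_vderiv_of_real_le [OF holomorphic_on_subset [OF F] t(1) _ fF x', rotated]) auto
  then show "norm (nth_vderiv n f x) \<le> fact n * ((2 * \<eta> + M) * \<epsilon> powr (- a)) * (64 / \<rho>\<^sup>2) ^ n"
    by (simp only: t_inv)
qed

section \<open>Growth of nets\<close>

lemma smooth_on_subset: "smooth_on S f \<Longrightarrow> T \<subseteq> S \<Longrightarrow> smooth_on T f"
  by (auto simp: smooth_on_def)

lemma
  assumes "open \<omega>" "smooth_on \<omega> f" "smooth_on \<omega> g"
  shows nth_vderiv_diff: "x \<in> \<omega> \<Longrightarrow> nth_vderiv n (\<lambda>x. f x - g x) x = nth_vderiv n f x - nth_vderiv n g x"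
    and smooth_on_diff: "smooth_on \<omega> (\<lambda>x. f x - g x)"
proof -
  have m: "smooth_on \<omega> (\<lambda>x. - g x)"
    using nth_vderiv_uminus(2) [OF assms(1,3)] by (simp add: smooth_on_def)
  show "x \<in> \<omega> \<Longrightarrow> nth_vderiv n (\<lambda>x. f x - g x) x = nth_vderiv n f x - nth_vderiv n g x"
    using nth_vderiv_add(1) [OF assms(1,2) m] nth_vderiv_uminus(1) [OF assms(1,3)] by simp
  show "smooth_on \<omega> (\<lambda>x. f x - g x)"
    using nth_vderiv_add(2) [OF assms(1,2) m] by (simp add: smooth_on_def)
qed

lemma eventually_unit_interval: "\<forall>\<^sub>F \<epsilon>::real in at_right 0. \<epsilon> \<in> {0<..<1}"
  by (rule eventually_at_right_real) simp

text \<open>Trades the supremum for pointwise bounds with a constant; smoothness and compactness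
  make the supremum an actual upper bound.\<close>

lemma sup_growth_iff:
  assumes f: "f \<in> smooth_nets \<omega>" and K: "compact K" "K \<noteq> {}" "K \<subseteq> \<omega>"
  shows "sup_growth f n K a \<longleftrightarrow>
    (\<exists>C. \<forall>\<^sub>F \<epsilon> in at_right 0. \<forall>x\<in>K. norm (nth_vderiv n (f \<epsilon>) x) \<le> C * \<epsilon> powr a)"
    (is "?L \<longleftrightarrow> ?R")
proof
  assume ?L
  then obtain C where "\<forall>\<^sub>F \<epsilon> in at_right 0.
      norm (SUP x\<in>K. norm (nth_vderiv n (f \<epsilon>) x)) \<le> C * norm (\<epsilon> powr a)"
    unfolding sup_growth_def by (elim landau_o.bigE)
  then have "\<forall>\<^sub>F \<epsilon> in at_right 0. \<forall>x\<in>K. norm (nth_vderiv n (f \<epsilon>) x) \<le> C * \<epsilon> powr a"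
    using eventually_unit_interval
  proof eventually_elim
    case (elim \<epsilon>)
    have "smooth_on \<omega> (f \<epsilon>)"
      using f elim(2) by (auto simp: smooth_nets_def)
    then have "norm (nth_vderiv n (f \<epsilon>) x) \<le> (SUP x\<in>K. norm (nth_vderiv n (f \<epsilon>) x))" if "x \<in> K" for x
      using that K by (intro cSUP_upper smooth_on_bdd_above)
    then show ?case using elim(1) by fastforce
  qed
  then show ?R by blast
next
  assume ?R
  then obtain C where C: "\<forall>\<^sub>F \<epsilon> in at_right 0. \<forall>x\<in>K. norm (nth_vderiv n (f \<epsilon>) x) \<le> C * \<epsilon> powr a"
    by blast
  obtain x where x: "x \<in> K" using K(2) by blast
  show ?L
    unfolding sup_growth_def
  proof (rule bigoI)
    show "\<forall>\<^sub>F \<epsilon> in at_right 0. norm (SUP x\<in>K. norm (nth_vderiv n (f \<epsilon>) x)) \<le> C * norm (\<epsilon> powr a)"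
      using C
    proof eventually_elim
      case (elim \<epsilon>)
      have "(SUP x\<in>K. norm (nth_vderiv n (f \<epsilon>) x)) \<le> C * \<epsilon> powr a"
        using elim K(2) by (intro cSUP_least) auto
      moreover have "0 \<le> (SUP x\<in>K. norm (nth_vderiv n (f \<epsilon>) x))"
        using elim x by (intro cSUP_upper2 [where x = x] bdd_aboveI2 [where M = "C * \<epsilon> powr a"]) auto
      ultimately show ?case by simp
    qed
  qed
qed

text \<open>Finite subcover. Absolute values let one sum bound local constants of any sign.\<close>

lemma growth_on_compact:
  fixes u :: "real \<Rightarrow> real \<Rightarrow> real"
  assumes K: "compact K"
    and loc: "\<And>x0. x0 \<in> K \<Longrightarrow> \<exists>r>0. \<exists>C. \<forall>\<^sub>F \<epsilon> in at_right 0. \<forall>x\<in>ball x0 r. u \<epsilon> x \<le> C * \<epsilon> powr a"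
  shows "\<exists>C. \<forall>\<^sub>F \<epsilon> in at_right 0. \<forall>x\<in>K. u \<epsilon> x \<le> C * \<epsilon> powr a"
proof -
  define Q where "Q x0 r C \<longleftrightarrow> (\<forall>\<^sub>F \<epsilon> in at_right 0. \<forall>x\<in>ball x0 r. u \<epsilon> x \<le> C * \<epsilon> powr a)" for x0 r C
  have "\<exists>r C. 0 < r \<and> Q x0 r C" if "x0 \<in> K" for x0
    using loc [OF that] unfolding Q_def by blast
  then obtain r C where rC: "\<And>x0. x0 \<in> K \<Longrightarrow> 0 < r x0" "\<And>x0. x0 \<in> K \<Longrightarrow> Q x0 (r x0) (C x0)"
    by metis
  have "K \<subseteq> (\<Union>x0\<in>K. ball x0 (r x0))"
    using rC(1) by auto
  with compactE_image [OF K, of K "\<lambda>x0. ball x0 (r x0)"]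
  obtain D where D: "D \<subseteq> K" "finite D" "K \<subseteq> (\<Union>x0\<in>D. ball x0 (r x0))"
    by auto
  have "\<forall>\<^sub>F \<epsilon> in at_right 0. \<forall>x0\<in>D. \<forall>x\<in>ball x0 (r x0). u \<epsilon> x \<le> C x0 * \<epsilon> powr a"
    using D rC(2) unfolding Q_def by (intro eventually_ball_finite) auto
  then have "\<forall>\<^sub>F \<epsilon> in at_right 0. \<forall>x\<in>K. u \<epsilon> x \<le> (\<Sum>x0\<in>D. \<bar>C x0\<bar>) * \<epsilon> powr a"
  proof eventually_elim
    case (elim \<epsilon>)
    show ?case
    proof
      fix x assume "x \<in> K"
      then obtain x0 where x0: "x0 \<in> D" "x \<in> ball x0 (r x0)"
        using D by blast
      then have "u \<epsilon> x \<le> C x0 * \<epsilon> powr a"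
        using elim by blast
      also have "C x0 \<le> \<bar>C x0\<bar>" by simp
      also have "\<dots> \<le> (\<Sum>x0\<in>D. \<bar>C x0\<bar>)"
        using x0 D by (intro member_le_sum) auto
      finally show "u \<epsilon> x \<le> (\<Sum>x0\<in>D. \<bar>C x0\<bar>) * \<epsilon> powr a"
        by (simp add: mult_right_mono)
    qed
  qed
  then show ?thesis by blast
qed

text \<open>C \<epsilon>^(a - b) tends to 0, so any loss in the exponent absorbs the constant. The
  conditions fed to the diagonal choice thereby become free of constants.\<close>

lemma eventually_growth_absorb_constant:
  fixes u :: "real \<Rightarrow> real \<Rightarrow> real"
  assumes "\<forall>\<^sub>F \<epsilon> in at_right 0. \<forall>x\<in>K. u \<epsilon> x \<le> C * \<epsilon> powr a" and "b < a"
  shows "\<forall>\<^sub>F \<epsilon> in at_right 0. \<forall>x\<in>K. u \<epsilon> x \<le> \<epsilon> powr b"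
proof -
  have "((\<lambda>\<epsilon>. C * \<epsilon> powr (a - b)) \<longlongrightarrow> 0) (at_right 0)"
    using assms(2) by real_asymp
  then have "\<forall>\<^sub>F \<epsilon> in at_right 0. C * \<epsilon> powr (a - b) < 1"
    by (rule order_tendstoD) simp
  with assms(1) eventually_unit_interval show ?thesis
  proof eventually_elim
    case (elim \<epsilon>)
    have "C * \<epsilon> powr a = C * \<epsilon> powr (a - b) * \<epsilon> powr b"
      using elim(2) by (simp add: powr_add [symmetric])
    also have "\<dots> \<le> 1 * \<epsilon> powr b"
      using elim(3) by (intro mult_right_mono) auto
    finally show ?case using elim(1) by auto
  qed
qed

text \<open>If stage k is valid below \<delta> k, the largest stage admissible at \<epsilon> is
  taken. Every stage is eventually admissible, so \<kappa> tends to infinity, as slowly as validity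
  demands.\<close>

lemma eventually_diagonal:
  fixes P :: "nat \<Rightarrow> real \<Rightarrow> bool"
  assumes "\<And>k. \<forall>\<^sub>F \<epsilon> in at_right 0. P k \<epsilon>"
  obtains \<kappa> :: "real \<Rightarrow> nat"
  where "filterlim \<kappa> at_top (at_right 0)" "\<forall>\<^sub>F \<epsilon> in at_right 0. P (\<kappa> \<epsilon>) \<epsilon>"
proof -
  have "\<exists>\<delta>>0. \<forall>\<epsilon>. 0 < \<epsilon> \<and> \<epsilon> < \<delta> \<longrightarrow> P k \<epsilon>" for k
    using assms [of k] by (auto simp: eventually_at_right_field)
  then obtain \<delta> where \<delta>: "\<And>k. 0 < \<delta> k" "\<And>k \<epsilon>. 0 < \<epsilon> \<Longrightarrow> \<epsilon> < \<delta> k \<Longrightarrow> P k \<epsilon>"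
    by metis
  \<comment> \<open>The condition k \<epsilon> \<le> 1 caps the admissible stages, so that the
    maximum exists even if \<delta> does not tend to 0.\<close>
  define S where "S \<epsilon> = {k. real k * \<epsilon> \<le> 1 \<and> \<epsilon> < \<delta> k}" for \<epsilon> :: real
  define \<kappa> where "\<kappa> \<epsilon> = Max (S \<epsilon>)" for \<epsilon>
  have finite: "finite (S \<epsilon>)" if "0 < \<epsilon>" for \<epsilon>
  proof (rule finite_subset)
    show "S \<epsilon> \<subseteq> {..nat \<lceil>1 / \<epsilon>\<rceil>}"
    proof
      fix k assume "k \<in> S \<epsilon>"
      then have "real k \<le> 1 / \<epsilon>"
        using that by (simp add: S_def pos_le_divide_eq)
      also have "\<dots> \<le> real (nat \<lceil>1 / \<epsilon>\<rceil>)"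
        by (rule of_nat_ceiling)
      finally show "k \<in> {..nat \<lceil>1 / \<epsilon>\<rceil>}" by simp
    qed
  qed simp
  have ev: "\<forall>\<^sub>F \<epsilon> in at_right 0. 0 < \<epsilon> \<and> k \<in> S \<epsilon>" for k
  proof -
    \<comment> \<open>The denominator k + 1 stays positive at k = 0, the stage that later shows
      \<open>S \<epsilon>\<close> to be nonempty.\<close>
    have "\<forall>\<^sub>F \<epsilon> in at_right 0. \<epsilon> \<in> {0<..<min (\<delta> k) (1 / (real k + 1))}"
      using \<delta>(1) [of k] by (intro eventually_at_right_real) simp
    then show ?thesis
    proof eventually_elim
      case (elim \<epsilon>)
      then have "(real k + 1) * \<epsilon> < 1"
        by (simp add: field_simps)
      then have "real k * \<epsilon> \<le> 1"
        using elim by (simp add: distrib_right)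
      then show ?case using elim by (auto simp: S_def)
    qed
  qed
  show ?thesis
  proof
    show "filterlim \<kappa> at_top (at_right 0)"
      unfolding filterlim_at_top
    proof
      fix k
      show "\<forall>\<^sub>F \<epsilon> in at_right 0. k \<le> \<kappa> \<epsilon>"
        using ev [of k] unfolding \<kappa>_def by eventually_elim (auto intro: Max_ge finite)
    qed
    show "\<forall>\<^sub>F \<epsilon> in at_right 0. P (\<kappa> \<epsilon>) \<epsilon>"
      using ev [of 0]
    proof eventually_elim
      case (elim \<epsilon>)
      then have "\<kappa> \<epsilon> \<in> S \<epsilon>"
        unfolding \<kappa>_def by (intro Max_in finite) auto
      then show ?case
        using elim \<delta>(2) by (auto simp: S_def)
    qed
  qed
qed

section \<open>Moderate and negligible nets\<close>

lemma moderate_nets_smooth_on: "f \<in> moderate_nets \<omega> \<Longrightarrow> \<epsilon> \<in> {0<..<1} \<Longrightarrow> smooth_on \<omega> (f \<epsilon>)"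
  by (auto simp: moderate_nets_def smooth_nets_def)

text \<open>Turns an equality of classes into a relation between two nets: the restricted class of
  \<open>h\<close> is the class of \<open>h\<close> on the ball, and \<open>g\<close> lies in its
  own class.\<close>

lemma real_analytic_at_classD:
  assumes "open \<omega>" "h \<in> moderate_nets \<omega>" "real_analytic_at \<omega> (colombeau_class \<omega> h) x"
  obtains r g where "0 < r" "ball x r \<subseteq> \<omega>" "(h, g) \<in> colombeau_rel (ball x r)" "analytic_bounds (ball x r) g"
proof -
  obtain r g where rg: "0 < r" "ball x r \<subseteq> \<omega>" "g \<in> moderate_nets (ball x r)"
    "colombeau_restrict (ball x r) (colombeau_class \<omega> h) = colombeau_class (ball x r) g"
    "analytic_bounds (ball x r) g"
    using assms(3) unfolding real_analytic_at_def by blast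
  then have "colombeau_class (ball x r) h = colombeau_class (ball x r) g"
    using colombeau_restrict_class [OF assms(1) open_ball rg(2) assms(2)] by simp
  moreover have "g \<in> colombeau_class (ball x r) g"
    unfolding colombeau_class_def
    using equiv_class_self [OF equiv_colombeau_rel [OF open_ball] rg(3)] .
  ultimately have "(h, g) \<in> colombeau_rel (ball x r)"
    unfolding colombeau_class_def by blast
  then show ?thesis using rg that by blast
qed

lemma moderate_netsE:
  assumes "h \<in> moderate_nets \<omega>" "compact K" "K \<subseteq> \<omega>"
  obtains C a where "\<forall>\<^sub>F \<epsilon> in at_right 0. \<forall>x\<in>K. norm (nth_vderiv n (h \<epsilon>) x) \<le> C * \<epsilon> powr a"
proof (cases "K = {}")
  case False
  then obtain a where "sup_growth h n K a"
    using assms unfolding moderate_nets_def by blast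
  then show ?thesis
    using that sup_growth_iff [of h \<omega> K n a] False assms unfolding moderate_nets_def by blast
qed (use that in simp)

lemma negligible_netsD:
  assumes "h \<in> negligible_nets \<omega>" "compact K" "K \<subseteq> \<omega>"
  shows "\<exists>C. \<forall>\<^sub>F \<epsilon> in at_right 0. \<forall>x\<in>K. norm (nth_vderiv n (h \<epsilon>) x) \<le> C * \<epsilon> powr a"
proof (cases "K = {}")
  case False
  then have "sup_growth h n K a"
    using assms unfolding negligible_nets_def by blast
  then show ?thesis
    using sup_growth_iff [of h \<omega> K n a] False assms unfolding negligible_nets_def by blast
qed simp

text \<open>Finite subcovers pass from points to compact sets. The radius may depend on the order n
  and the exponent b.\<close>

lemma negligible_nets_locally:
  assumes u: "u \<in> smooth_nets \<omega>"
    and loc: "\<And>x0 n b. x0 \<in> \<omega> \<Longrightarrow> \<exists>r>0. \<exists>C. \<forall>\<^sub>F \<epsilon> in at_right 0. \<forall>x\<in>ball x0 r.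
      norm (nth_vderiv n (u \<epsilon>) x) \<le> C * \<epsilon> powr b"
  shows "u \<in> negligible_nets \<omega>"
  unfolding negligible_nets_def
proof (intro CollectI conjI allI impI u)
  fix K n b assume K: "compact K \<and> K \<noteq> {} \<and> K \<subseteq> \<omega>"
  then have "\<exists>C. \<forall>\<^sub>F \<epsilon> in at_right 0. \<forall>x\<in>K. norm (nth_vderiv n (u \<epsilon>) x) \<le> C * \<epsilon> powr b"
    using loc by (intro growth_on_compact) blast+
  then show "sup_growth u n K b"
    using sup_growth_iff [OF u] K by blast
qed

text \<open>Writing f = h - (h - f), only the difference from a known moderate net has to be
  estimated.\<close>

lemma moderate_nets_negligible_perturbation:
  assumes "open \<omega>" "h \<in> moderate_nets \<omega>" "f \<in> smooth_nets \<omega>"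
    and neg: "(\<lambda>\<epsilon> x. h \<epsilon> x - f \<epsilon> x) \<in> negligible_nets \<omega>"
  shows "f \<in> moderate_nets \<omega>"
  unfolding moderate_nets_def
proof (intro CollectI conjI allI impI assms(3))
  fix K n assume K: "compact K \<and> K \<noteq> {} \<and> K \<subseteq> \<omega>"
  obtain C a where C: "\<forall>\<^sub>F \<epsilon> in at_right 0. \<forall>x\<in>K. norm (nth_vderiv n (h \<epsilon>) x) \<le> C * \<epsilon> powr a"
    using K by (elim conjE moderate_netsE [OF assms(2), where n = n])
  obtain C' where C': "\<forall>\<^sub>F \<epsilon> in at_right 0. \<forall>x\<in>K. norm (nth_vderiv n (\<lambda>x. h \<epsilon> x - f \<epsilon> x) x) \<le> C' * \<epsilon> powr a"
    using negligible_netsD [OF neg] K by blast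
  from C C' eventually_unit_interval
  have "\<forall>\<^sub>F \<epsilon> in at_right 0. \<forall>x\<in>K. norm (nth_vderiv n (f \<epsilon>) x) \<le> (C + C') * \<epsilon> powr a"
  proof eventually_elim
    case (elim \<epsilon>)
    show ?case
    proof
      fix x assume x: "x \<in> K"
      then have "nth_vderiv n (\<lambda>x. h \<epsilon> x - f \<epsilon> x) x = nth_vderiv n (h \<epsilon>) x - nth_vderiv n (f \<epsilon>) x"
        using elim(3) assms K
        by (intro nth_vderiv_diff [OF \<open>open \<omega>\<close>]) (auto simp: smooth_nets_def moderate_nets_def)
      then have "norm (nth_vderiv n (f \<epsilon>) x) \<le>
          norm (nth_vderiv n (h \<epsilon>) x) + norm (nth_vderiv n (\<lambda>x. h \<epsilon> x - f \<epsilon> x) x)"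
        using norm_triangle_ineq4 [of "nth_vderiv n (h \<epsilon>) x" "nth_vderiv n (h \<epsilon>) x - nth_vderiv n (f \<epsilon>) x"] by simp
      then show "norm (nth_vderiv n (f \<epsilon>) x) \<le> (C + C') * \<epsilon> powr a"
        using elim(1,2) x by (fastforce simp: distrib_right)
    qed
  qed
  then show "\<exists>a. sup_growth f n K a"
    using sup_growth_iff [OF assms(3)] K by blast
qed

text \<open>The constants M and s are merged into \<eta> = max M s, as the definition has a single
  base with exponent n + 1.\<close>

lemma analytic_boundsI:
  assumes a: "0 < a" and M: "0 < M" and s: "0 < s"
    and ev: "\<forall>\<^sub>F \<epsilon> in at_right 0. \<forall>n. \<forall>x\<in>B.
      norm (nth_vderiv n (f \<epsilon>) x) \<le> fact n * (M * \<epsilon> powr (- a)) * s ^ n"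
  shows "analytic_bounds B f"
proof -
  define \<eta> where "\<eta> = max M s"
  obtain d where d: "0 < d" "\<And>\<epsilon>. 0 < \<epsilon> \<Longrightarrow> \<epsilon> < d \<Longrightarrow> \<forall>n. \<forall>x\<in>B.
      norm (nth_vderiv n (f \<epsilon>) x) \<le> fact n * (M * \<epsilon> powr (- a)) * s ^ n"
    using ev unfolding eventually_at_right_field by blast
  have "norm (nth_vderiv n (f \<epsilon>) x) \<le> \<eta> ^ (n + 1) * fact n * \<epsilon> powr (- a)"
    if "\<epsilon> \<in> {0<..<min d (1/2)}" "x \<in> B" for n \<epsilon> x
  proof -
    have "norm (nth_vderiv n (f \<epsilon>) x) \<le> fact n * (M * \<epsilon> powr (- a)) * s ^ n"
      using d(2) [of \<epsilon>] that by auto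
    also have "\<dots> = (M * s ^ n) * (fact n * \<epsilon> powr (- a))"
      by simp
    also have "\<dots> \<le> (\<eta> * \<eta> ^ n) * (fact n * \<epsilon> powr (- a))"
      using M s by (intro mult_right_mono mult_mono power_mono) (auto simp: \<eta>_def)
    finally show ?thesis by (simp add: mult_ac)
  qed
  moreover have "0 < \<eta>" "min d (1/2) \<in> {0<..<1}"
    using M d(1) by (auto simp: \<eta>_def)
  ultimately show ?thesis
    unfolding analytic_bounds_def using a by blast
qed

section \<open>The global representative\<close>

text \<open>\<open>C'\<close> is the exhaustion \<open>C\<close> shifted by one. As each member lies
  in the interior of the next, Urysohn's lemma separates it from the complement of that interior.
  Continuous cutoffs suffice because the kernel smooths.\<close>

lemma compact_exhaustion_with_cutoffs:
  fixes \<omega> :: "real set"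
  assumes "open \<omega>"
  obtains C C' :: "nat \<Rightarrow> real set" and \<psi> :: "nat \<Rightarrow> real \<Rightarrow> complex" and R :: "nat \<Rightarrow> real"
  where "\<And>k. compact (C' k)" "\<And>k. C' k \<subseteq> \<omega>" "\<And>k. C' k \<subseteq> {- R k..R k}" "\<And>k. C k \<subseteq> C' k"
    "\<And>K. compact K \<Longrightarrow> K \<subseteq> \<omega> \<Longrightarrow> \<exists>N. \<forall>n\<ge>N. K \<subseteq> C n"
    "\<And>k. continuous_on UNIV (\<psi> k)" "\<And>k y. norm (\<psi> k y) \<le> 1"
    "\<And>k y. y \<in> C k \<Longrightarrow> \<psi> k y = 1" "\<And>k y. y \<notin> C' k \<Longrightarrow> \<psi> k y = 0"
proof -
  obtain C where C: "\<And>n. compact (C n)" "\<And>n. C n \<subseteq> \<omega>" "\<And>n. C n \<subseteq> interior (C (Suc n))"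
    "\<And>K. \<lbrakk>compact K; K \<subseteq> \<omega>\<rbrakk> \<Longrightarrow> \<exists>N. \<forall>n\<ge>N. K \<subseteq> C n"
    using open_Union_compact_subsets [OF assms] by metis
  have "\<exists>R. C (Suc k) \<subseteq> {-R..R}" for k
  proof -
    obtain R where "\<forall>x\<in>C (Suc k). \<bar>x\<bar> \<le> R"
      using compact_imp_bounded [OF C(1)] unfolding bounded_iff by (metis real_norm_def)
    then show ?thesis by (intro exI [of _ R]) (force simp: abs_le_iff)
  qed
  then obtain R where R: "\<And>k. C (Suc k) \<subseteq> {- R k..R k}" by metis
  have "\<exists>\<psi> :: real \<Rightarrow> complex. continuous_on UNIV \<psi> \<and> (\<forall>y. norm (\<psi> y) \<le> 1) \<and>
      (\<forall>y\<in>C k. \<psi> y = 1) \<and> (\<forall>y. y \<notin> C (Suc k) \<longrightarrow> \<psi> y = 0)" for k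
  proof -
    have "closedin (top_of_set UNIV) (C k)" "closedin (top_of_set UNIV) (- interior (C (Suc k)))"
      "C k \<inter> - interior (C (Suc k)) = {}"
      using C(1,3) by (auto simp: compact_imp_closed)
    from Urysohn_local [OF this, of "1::complex" 0]
    obtain \<psi> :: "real \<Rightarrow> complex" where \<psi>: "continuous_on UNIV \<psi>" "\<And>y. \<psi> y \<in> closed_segment 1 0"
      "\<And>y. y \<in> C k \<Longrightarrow> \<psi> y = 1" "\<And>y. y \<in> - interior (C (Suc k)) \<Longrightarrow> \<psi> y = 0"
      by (metis UNIV_I)
    have "closed_segment 1 (0::complex) \<subseteq> cball 0 1"
      by (intro closed_segment_subset) auto
    then have "norm (\<psi> y) \<le> 1" for y
      using \<psi>(2) [of y] by auto
    moreover have "\<psi> y = 0" if "y \<notin> C (Suc k)" for y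
      using \<psi>(4) that interior_subset by blast
    ultimately show ?thesis using \<psi>(1,3) by blast
  qed
  then obtain \<psi> :: "nat \<Rightarrow> real \<Rightarrow> complex" where
    "\<And>k. continuous_on UNIV (\<psi> k)" "\<And>k y. norm (\<psi> k y) \<le> 1"
    "\<And>k y. y \<in> C k \<Longrightarrow> \<psi> k y = 1" "\<And>k y. y \<notin> C (Suc k) \<Longrightarrow> \<psi> k y = 0"
    by metis
  with C R that [of "\<lambda>k. C (Suc k)" R C \<psi>] show ?thesis
    using interior_subset by (metis order_trans)
qed

text \<open>The values of \<open>h\<close> off \<omega> are arbitrary. The product is continuous on
  \<omega> and zero on the complement of \<open>C\<close>, and these two open sets cover the
  line.\<close>

lemma continuous_on_mult_cutoff:
  fixes \<psi> h :: "real \<Rightarrow> complex"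
  assumes "open \<omega>" "compact C" "C \<subseteq> \<omega>" "continuous_on \<omega> h" "continuous_on UNIV \<psi>"
    "\<And>y. y \<notin> C \<Longrightarrow> \<psi> y = 0"
  shows "continuous_on UNIV (\<lambda>y. \<psi> y * h y)"
proof -
  have "continuous_on \<omega> (\<lambda>y. \<psi> y * h y)"
    using assms(4,5) by (intro continuous_on_mult) (auto elim: continuous_on_subset)
  moreover have "continuous_on (- C) (\<lambda>y. \<psi> y * h y)"
    using assms(6) by (subst continuous_on_cong [OF refl, of _ _ "\<lambda>_. 0"]) auto
  ultimately have "continuous_on (\<omega> \<union> - C) (\<lambda>y. \<psi> y * h y)"
    using assms(1,2) by (intro continuous_on_open_Un) (auto simp: compact_imp_closed)
  moreover have "\<omega> \<union> - C = UNIV" using assms(3) by blast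
  ultimately show ?thesis by simp
qed

theorem theorem2:
  fixes \<omega> :: "real set" and F :: "net set"
  assumes "open \<omega>" and "F \<in> colombeau_analytic \<omega>"
  shows "\<exists>f\<in>moderate_nets \<omega>.
           F = colombeau_class \<omega> f \<and>
           (\<forall>\<epsilon>\<in>{0<..<1}. real_analytic_on \<omega> (f \<epsilon>)) \<and>
           (\<forall>x0\<in>\<omega>. \<exists>r>0. ball x0 r \<subseteq> \<omega> \<and>
              colombeau_restrict (ball x0 r) F = colombeau_class (ball x0 r) f \<and>
              analytic_bounds (ball x0 r) f)"
proof -

  \<comment> \<open>A countable cover by local analytic representatives\<close>
  have "F \<in> moderate_nets \<omega> // colombeau_rel \<omega>"
    using assms(2) by (simp add: colombeau_analytic_def colombeau_algebra_def)
  then obtain h where h: "h \<in> moderate_nets \<omega>" "F = colombeau_class \<omega> h"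
    by (auto simp: quotient_def colombeau_class_def)
  have "\<exists>r g. 0 < r \<and> ball x r \<subseteq> \<omega> \<and> (h, g) \<in> colombeau_rel (ball x r) \<and> analytic_bounds (ball x r) g"
    if "x \<in> \<omega>" for x
  proof -
    have "real_analytic_at \<omega> (colombeau_class \<omega> h) x"
      using assms(2) that h(2) by (simp add: colombeau_analytic_def)
    then show ?thesis
      by (rule real_analytic_at_classD [OF assms(1) h(1)]) blast
  qed
  then obtain r g where rg: "\<And>x. x \<in> \<omega> \<Longrightarrow> 0 < r x" "\<And>x. x \<in> \<omega> \<Longrightarrow> ball x (r x) \<subseteq> \<omega>"
    "\<And>x. x \<in> \<omega> \<Longrightarrow> (h, g x) \<in> colombeau_rel (ball x (r x))"
    "\<And>x. x \<in> \<omega> \<Longrightarrow> analytic_bounds (ball x (r x)) (g x)"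
    by metis
  \<comment> \<open>Halving the radius places the closure of \<open>U x\<close> as a compact set
    inside the ball, so negligibility gives uniform bounds on \<open>U x\<close>.\<close>
  define U where "U x = ball x (r x / 2)" for x
  have diff_growth: "\<exists>C. \<forall>\<^sub>F \<epsilon> in at_right 0. \<forall>y\<in>U x. norm (nth_vderiv n (\<lambda>y. h \<epsilon> y - g x \<epsilon> y) y) \<le> C * \<epsilon> powr b"
    if "x \<in> \<omega>" for x n b
  proof -
    have "(\<lambda>\<epsilon> y. h \<epsilon> y - g x \<epsilon> y) \<in> negligible_nets (ball x (r x))"
      using rg(3) [OF that] by (simp add: colombeau_rel_def)
    moreover have "cball x (r x / 2) \<subseteq> ball x (r x)"
      using rg(1) [OF that] by (auto simp: cball_subset_ball_iff)
    ultimately obtain C where "\<forall>\<^sub>F \<epsilon> in at_right 0. \<forall>y\<in>cball x (r x / 2).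
        norm (nth_vderiv n (\<lambda>y. h \<epsilon> y - g x \<epsilon> y) y) \<le> C * \<epsilon> powr b"
      using negligible_netsD [OF _ compact_cball] by blast
    then have "\<forall>\<^sub>F \<epsilon> in at_right 0. \<forall>y\<in>U x. norm (nth_vderiv n (\<lambda>y. h \<epsilon> y - g x \<epsilon> y) y) \<le> C * \<epsilon> powr b"
      by (rule eventually_mono) (auto simp: U_def)
    then show ?thesis by blast
  qed
  \<comment> \<open>A countable subcover can be enumerated, so that each stage of the diagonal
    choice treats only finitely many local representatives.\<close>
  obtain S where S: "countable S" "S \<subseteq> \<omega>" "\<omega> \<subseteq> (\<Union>x\<in>S. U x)"
  proof -
    obtain \<F> where \<F>: "\<F> \<subseteq> U ` \<omega>" "countable \<F>" "\<Union>\<F> = \<Union>(U ` \<omega>)"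
      by (rule Lindelof [of "U ` \<omega>"]) (auto simp: U_def)
    obtain S where S: "countable S" "S \<subseteq> \<omega>" "\<F> = U ` S"
      using \<F>(1,2) countable_subset_image [of \<F> U \<omega>] by blast
    have "\<omega> \<subseteq> \<Union>(U ` \<omega>)"
      using rg(1) by (auto simp: U_def)
    then show ?thesis
      using S \<F>(3) by (intro that [of S]) simp_all
  qed

  \<comment> \<open>Cutoffs, growth exponents and the slow parameter\<close>
  obtain C C' :: "nat \<Rightarrow> real set" and \<psi> :: "nat \<Rightarrow> real \<Rightarrow> complex" and R :: "nat \<Rightarrow> real"
    where C': "\<And>k. compact (C' k)" "\<And>k. C' k \<subseteq> \<omega>" "\<And>k. C' k \<subseteq> {- R k..R k}" "\<And>k. C k \<subseteq> C' k"
      and C: "\<And>K. compact K \<Longrightarrow> K \<subseteq> \<omega> \<Longrightarrow> \<exists>N. \<forall>n\<ge>N. K \<subseteq> C n"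
      and \<psi>: "\<And>k. continuous_on UNIV (\<psi> k)" "\<And>k y. norm (\<psi> k y) \<le> 1"
        "\<And>k y. y \<in> C k \<Longrightarrow> \<psi> k y = 1" "\<And>k y. y \<notin> C' k \<Longrightarrow> \<psi> k y = 0"
    by (rule compact_exhaustion_with_cutoffs [OF assms(1)]) blast
  define Q where "Q k A \<longleftrightarrow> (\<forall>\<^sub>F \<epsilon> in at_right 0. \<forall>y\<in>C' k. norm (h \<epsilon> y) \<le> \<epsilon> powr (- A))" for k A
  have "\<exists>A\<ge>0. Q k A" for k
  proof -
    obtain c a where "\<forall>\<^sub>F \<epsilon> in at_right 0. \<forall>y\<in>C' k. norm (nth_vderiv 0 (h \<epsilon>) y) \<le> c * \<epsilon> powr a"
      by (rule moderate_netsE [OF h(1) C'(1,2)])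
    \<comment> \<open>The exponent -(|a| + 1) lies strictly below a, which absorbs \<open>c\<close>,
      and makes A = |a| + 1 nonnegative.\<close>
    then have "\<forall>\<^sub>F \<epsilon> in at_right 0. \<forall>y\<in>C' k. norm (nth_vderiv 0 (h \<epsilon>) y) \<le> \<epsilon> powr (- (\<bar>a\<bar> + 1))"
      by (rule eventually_growth_absorb_constant) simp
    then show ?thesis
      unfolding Q_def by (intro exI [of _ "\<bar>a\<bar> + 1"]) simp
  qed
  then obtain A where A: "\<And>k. 0 \<le> A k" "\<And>k. Q k (A k)"
    by metis
  \<comment> \<open>The factor \<open>1 + A k\<close> lets \<open>e\<^bsup>-cL\<^esup>\<close> beat the growth \<open>\<epsilon>\<^bsup>-A(k)\<^esup>\<close> of \<open>h\<close> on \<open>C' k\<close>,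
    although \<open>A k\<close> may grow arbitrarily fast.\<close>
  define l where "l k = real k * (1 + A k)" for k
  \<comment> \<open>The demands of stage k at \<epsilon>. The exponent 3 l k outweighs the
    amplification exp (2 L) = \<epsilon>^(-2 l k) with l k to spare; the bound on \<open>R k\<close>
    tames the length of the interval of integration.\<close>
  define P where "P k \<epsilon> \<longleftrightarrow> (\<forall>y\<in>C' k. norm (h \<epsilon> y) \<le> \<epsilon> powr (- A k)) \<and> R k \<le> \<epsilon> powr (-1) \<and>
      (\<forall>x\<in>{x\<in>S. to_nat_on S x \<le> k}. \<forall>y\<in>U x. norm (h \<epsilon> y - g x \<epsilon> y) \<le> \<epsilon> powr (3 * l k))" for k \<epsilon>
  have "\<forall>\<^sub>F \<epsilon> in at_right 0. P k \<epsilon>" for k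
    unfolding P_def
  proof (intro eventually_conj A(2) [unfolded Q_def])
    show "\<forall>\<^sub>F \<epsilon> in at_right 0. R k \<le> \<epsilon> powr (-1)"
      by real_asymp
    have "inj_on (to_nat_on S) {x\<in>S. to_nat_on S x \<le> k}"
      using inj_on_to_nat_on [OF S(1)] by (rule inj_on_subset) auto
    then have "finite {x\<in>S. to_nat_on S x \<le> k}"
      by (rule inj_on_finite [of _ _ "{..k}"]) auto
    then show "\<forall>\<^sub>F \<epsilon> in at_right 0. \<forall>x\<in>{x\<in>S. to_nat_on S x \<le> k}. \<forall>y\<in>U x.
        norm (h \<epsilon> y - g x \<epsilon> y) \<le> \<epsilon> powr (3 * l k)"
    proof (rule eventually_ball_finite, intro ballI)
      fix x assume "x \<in> {x\<in>S. to_nat_on S x \<le> k}"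
      then obtain c where "\<forall>\<^sub>F \<epsilon> in at_right 0. \<forall>y\<in>U x.
          norm (nth_vderiv 0 (\<lambda>y. h \<epsilon> y - g x \<epsilon> y) y) \<le> c * \<epsilon> powr (3 * l k + 1)"
        using diff_growth S(2) by blast
      then have "\<forall>\<^sub>F \<epsilon> in at_right 0. \<forall>y\<in>U x.
          norm (nth_vderiv 0 (\<lambda>y. h \<epsilon> y - g x \<epsilon> y) y) \<le> \<epsilon> powr (3 * l k)"
        by (rule eventually_growth_absorb_constant) simp
      then show "\<forall>\<^sub>F \<epsilon> in at_right 0. \<forall>y\<in>U x. norm (h \<epsilon> y - g x \<epsilon> y) \<le> \<epsilon> powr (3 * l k)"
        by simp
    qed
  qed
  then obtain \<kappa> where \<kappa>: "filterlim \<kappa> at_top (at_right 0)" "\<forall>\<^sub>F \<epsilon> in at_right 0. P (\<kappa> \<epsilon>) \<epsilon>"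
    by (rule eventually_diagonal)
  have \<kappa>_large: "\<forall>\<^sub>F \<epsilon> in at_right 0. X \<le> c * real (\<kappa> \<epsilon>)" if "0 < c" for X c
  proof -
    have "\<forall>\<^sub>F \<epsilon> in at_right 0. nat \<lceil>X / c\<rceil> \<le> \<kappa> \<epsilon>"
      using \<kappa>(1) unfolding filterlim_at_top by (rule spec)
    then show ?thesis
    proof eventually_elim
      case (elim \<epsilon>)
      then have "X / c \<le> real (\<kappa> \<epsilon>)" by (simp only: nat_ceiling_le_eq)
      then show ?case using that by (simp add: divide_le_eq mult.commute)
    qed
  qed

  \<comment> \<open>The regularized net\<close>
  define \<phi> where "\<phi> \<epsilon> y = \<psi> (\<kappa> \<epsilon>) y * h \<epsilon> y" for \<epsilon> y
  define Fc where "Fc \<epsilon> z = integral {- R (\<kappa> \<epsilon>)..R (\<kappa> \<epsilon>)}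
    (\<lambda>y. sinc_gauss (l (\<kappa> \<epsilon>) * ln (1 / \<epsilon>)) (z - of_real y) * \<phi> \<epsilon> y)" for \<epsilon> z
  define f :: net where "f \<epsilon> x = Fc \<epsilon> (of_real x)" for \<epsilon> x
  have cont_\<phi>: "continuous_on X (\<phi> \<epsilon>)" if "\<epsilon> \<in> {0<..<1}" for \<epsilon> X
  proof -
    have "continuous_on \<omega> (h \<epsilon>)"
      using moderate_nets_smooth_on [OF h(1) that] unfolding smooth_on_def
      by (intro continuous_at_imp_continuous_on ballI differentiable_imp_continuous_within)
         (metis nth_vderiv_0)
    then have "continuous_on UNIV (\<phi> \<epsilon>)"
      unfolding \<phi>_def using \<psi>(4)
      by (rule continuous_on_mult_cutoff [OF assms(1) C'(1,2) _ \<psi>(1)])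
    then show ?thesis by (rule continuous_on_subset) simp
  qed
  have Fc: "Fc \<epsilon> holomorphic_on UNIV" if "\<epsilon> \<in> {0<..<1}" for \<epsilon>
    unfolding Fc_def by (intro holomorphic_sinc_gauss_convolution cont_\<phi> that)
  have analytic: "real_analytic_on \<omega> (f \<epsilon>)" if "\<epsilon> \<in> {0<..<1}" for \<epsilon>
    unfolding f_def using real_analytic_on_of_real [OF Fc [OF that] assms(1)] .
  have smooth_f: "smooth_on X (f \<epsilon>)" if "\<epsilon> \<in> {0<..<1}" for \<epsilon> X
    using smooth_on_of_real [OF Fc [OF that] open_UNIV open_UNIV, of "f \<epsilon>"]
    by (auto simp: f_def elim: smooth_on_subset)

  \<comment> \<open>Comparison with the local analytic representatives\<close>
  have local: "\<exists>s>0. ball x0 s \<subseteq> \<omega> \<and> analytic_bounds (ball x0 s) f \<and>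
      (\<forall>n b. \<exists>M. \<forall>\<^sub>F \<epsilon> in at_right 0. \<forall>x\<in>ball x0 s.
         norm (nth_vderiv n (\<lambda>y. h \<epsilon> y - f \<epsilon> y) x) \<le> M * \<epsilon> powr b)"
    if x0: "x0 \<in> \<omega>" for x0
  proof -
    obtain x where x: "x \<in> S" "x0 \<in> U x" using S x0 by blast
    then have x\<omega>: "x \<in> \<omega>" using S by blast
    have U_ball: "U x \<subseteq> ball x (r x)"
      using rg(1) [OF x\<omega>] by (auto simp: U_def)
    obtain \<eta> a \<epsilon>0 where \<eta>: "0 < \<eta>" "0 < a" "\<epsilon>0 \<in> {0<..<1}"
      "\<And>\<epsilon> n y. \<epsilon> \<in> {0<..<\<epsilon>0} \<Longrightarrow> y \<in> ball x (r x) \<Longrightarrow>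
        norm (nth_vderiv n (g x \<epsilon>) y) \<le> \<eta> ^ (n + 1) * fact n * \<epsilon> powr (- a)"
      using rg(4) [OF x\<omega>] unfolding analytic_bounds_def by blast
    obtain d where d: "0 < d" "ball x0 d \<subseteq> U x"
      using x(2) by (metis U_def open_ball open_contains_ball)
    \<comment> \<open>Three demands: \<rho> \<le> 1 for the kernel estimates, 2 \<rho> \<le> d to
      stay in \<open>U x\<close>, and 4 \<rho> \<eta> \<le> 1 for the holomorphic extension of the
      local representative.\<close>
    define \<rho> where "\<rho> = min (min 1 (d / 2)) (1 / (4 * \<eta>))"
    have \<rho>: "0 < \<rho>" "\<rho> \<le> 1" "2 * \<rho> \<le> d" "4 * \<rho> * \<eta> \<le> 1"
    proof -
      show "0 < \<rho>" "\<rho> \<le> 1" "2 * \<rho> \<le> d"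
        using d \<eta> by (auto simp: \<rho>_def)
      have "\<rho> \<le> 1 / (4 * \<eta>)" by (simp add: \<rho>_def)
      then show "4 * \<rho> * \<eta> \<le> 1" using \<eta>(1) by (simp add: field_simps)
    qed
    have ball_U: "ball x0 (2 * \<rho>) \<subseteq> U x"
      using d \<rho> subset_ball [of "2 * \<rho>" d x0] by blast
    have near_U: "{x0 - \<rho>..x0 + \<rho>} \<subseteq> U x"
    proof -
      have "{x0 - \<rho>..x0 + \<rho>} \<subseteq> ball x0 (2 * \<rho>)"
        using \<rho>(1) by (auto simp: dist_real_def)
      then show ?thesis using ball_U by blast
    qed
    \<comment> \<open>From stage \<open>N\<close> on the cutoff is 1 on the whole segment, so \<phi>
      agrees there with \<open>h\<close>.\<close>
    obtain N where N: "\<And>n. N \<le> n \<Longrightarrow> {x0 - \<rho>..x0 + \<rho>} \<subseteq> C n"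
      using C [of "{x0 - \<rho>..x0 + \<rho>}"] near_U U_ball rg(2) [OF x\<omega>] by (metis compact_Icc subset_trans)
    define s where "s = \<rho>\<^sup>2 / 64"
    have s: "0 < s" "ball x0 s \<subseteq> ball x0 (2 * \<rho>)"
    proof -
      have "\<rho>\<^sup>2 \<le> \<rho>" using \<rho>(1,2) by (simp add: power2_eq_square mult_left_le)
      then show "0 < s" "ball x0 s \<subseteq> ball x0 (2 * \<rho>)"
        using \<rho>(1) by (auto simp: s_def)
    qed
    define c where "c = \<rho>\<^sup>2 / 16"
    have c: "0 < c" using \<rho> by (simp add: c_def)
    define M where "M = 256 * \<eta> / \<rho>\<^sup>2 + 4 / \<rho> + 2"
    have M0: "0 < M"
      using \<rho> \<eta> by (simp add: M_def add_pos_pos)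
    have estimates: "\<forall>\<^sub>F \<epsilon> in at_right 0. \<forall>n. \<forall>y\<in>ball x0 s.
        norm (nth_vderiv n (\<lambda>y. f \<epsilon> y - g x \<epsilon> y) y) \<le> fact n * (M * \<epsilon> powr b) * (64 / \<rho>\<^sup>2) ^ n \<and>
        norm (nth_vderiv n (f \<epsilon>) y) \<le> fact n * ((2 * \<eta> + M) * \<epsilon> powr (- a)) * (64 / \<rho>\<^sup>2) ^ n"
      if b: "- a \<le> b" for b
    proof -
      \<comment> \<open>Below exp (-1) the logarithm ln (1 / \<epsilon>) exceeds 1; with \<kappa>
        \<ge> 1 this gives L \<ge> 1. The other thresholds on \<kappa> secure the decay, put the
        segment where the cutoff is 1, and admit x to the finite list of the stage.\<close>
      have "\<forall>\<^sub>F \<epsilon> in at_right 0. \<epsilon> \<in> {0<..<min \<epsilon>0 (exp (-1))}"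
        using \<eta>(3) by (intro eventually_at_right_real) simp
      from \<kappa>(2) this \<kappa>_large [OF c, of "a + b"] \<kappa>_large [OF c, of "1 + b"] \<kappa>_large [OF c, of 1]
        \<kappa>_large [of 1 b, simplified] \<kappa>_large [of 1 "real N", simplified]
        \<kappa>_large [of 1 "real (to_nat_on S x)", simplified] \<kappa>_large [of 1 1, simplified]
      show ?thesis
      proof eventually_elim
        case (elim \<epsilon>)
        let ?k = "\<kappa> \<epsilon>"
        have P: "P ?k \<epsilon>" and \<epsilon>: "0 < \<epsilon>" "\<epsilon> < \<epsilon>0" "\<epsilon> < exp (-1)" "\<epsilon> \<in> {0<..<1}"
          using elim(1,2) \<eta>(3) by auto
        have near_C: "{x0 - \<rho>..x0 + \<rho>} \<subseteq> C ?k"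
          using N elim(7) by simp
        have "ln \<epsilon> < -1"
          using \<epsilon> by (metis ln_exp ln_less_cancel_iff exp_gt_zero)
        then have ln: "1 \<le> ln (1 / \<epsilon>)"
          using \<epsilon> by (simp add: ln_div)
        have "1 * 1 \<le> l ?k"
          unfolding l_def using A(1) [of ?k] elim(9) by (intro mult_mono) auto
        then have l1: "1 \<le> l ?k * ln (1 / \<epsilon>)"
          using ln mult_mono [of 1 "l ?k" 1 "ln (1 / \<epsilon>)"] by simp
        have \<phi>_bound: "norm (\<phi> \<epsilon> y) \<le> \<epsilon> powr (- A ?k)" for y
        proof (cases "y \<in> C' ?k")
          case True
          then have "norm (h \<epsilon> y) \<le> \<epsilon> powr (- A ?k)"
            using P by (simp add: P_def)
          moreover have "norm (\<phi> \<epsilon> y) \<le> 1 * norm (h \<epsilon> y)"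
            unfolding \<phi>_def norm_mult by (intro mult_right_mono \<psi>(2)) simp
          ultimately show ?thesis by simp
        qed (simp add: \<phi>_def \<psi>(4))
        have near: "norm (\<phi> \<epsilon> y - g x \<epsilon> y) \<le> \<epsilon> powr (3 * l ?k)" if "y \<in> {x0 - \<rho>..x0 + \<rho>}" for y
        proof -
          have "\<psi> ?k y = 1" using near_C that by (intro \<psi>(3)) blast
          moreover have "norm (h \<epsilon> y - g x \<epsilon> y) \<le> \<epsilon> powr (3 * l ?k)"
            using P x(1) elim(8) near_U that unfolding P_def by blast
          ultimately show ?thesis by (simp add: \<phi>_def)
        qed
        have "smooth_on (ball x (r x)) (g x \<epsilon>)"
          using rg(3) [OF x\<omega>] \<epsilon>(4) by (intro moderate_nets_smooth_on) (auto simp: colombeau_rel_def)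
        then have smooth_g: "smooth_on (ball x0 (2 * \<rho>)) (g x \<epsilon>)"
          by (rule smooth_on_subset) (use ball_U U_ball in blast)
        have bound_g: "norm (nth_vderiv n (g x \<epsilon>) y) \<le> \<eta> ^ (n + 1) * fact n * \<epsilon> powr (- a)"
          if "y \<in> ball x0 (2 * \<rho>)" for n y
        proof (rule \<eta>(4))
          show "y \<in> ball x (r x)" using that ball_U U_ball by blast
        qed (use \<epsilon> in auto)
        have R: "{x0 - \<rho>..x0 + \<rho>} \<subseteq> {- R ?k..R ?k}" "R ?k \<le> \<epsilon> powr (-1)"
          using near_C C'(3,4) [of ?k] P by (blast, simp add: P_def)
        have f: "f \<epsilon> y = integral {- R ?k..R ?k} (\<lambda>w. sinc_gauss (l ?k * ln (1 / \<epsilon>)) (of_real y - of_real w) * \<phi> \<epsilon> w)" for y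
          by (simp add: f_def Fc_def)
        show ?case
          using sinc_gauss_convolution_derivatives [OF \<rho>(1,2) \<eta>(1) \<rho>(4) smooth_g bound_g \<epsilon>(4) A(1) b
              _ elim(3-5) [unfolded c_def] elim(6) l_def l1 cont_\<phi> [OF \<epsilon>(4)] \<phi>_bound R near f]
          unfolding M_def s_def by simp
      qed
    qed
    \<comment> \<open>Only the growth bound on \<open>f\<close> matters here, so the estimates are
      taken at the smallest admissible exponent b = -a.\<close>
    have "analytic_bounds (ball x0 s) f"
    proof (rule analytic_boundsI)
      show "\<forall>\<^sub>F \<epsilon> in at_right 0. \<forall>n. \<forall>y\<in>ball x0 s.
          norm (nth_vderiv n (f \<epsilon>) y) \<le> fact n * ((2 * \<eta> + M) * \<epsilon> powr (- a)) * (64 / \<rho>\<^sup>2) ^ n"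
        using estimates [OF order_refl] by (rule eventually_mono) blast
      show "0 < 2 * \<eta> + M" "0 < 64 / \<rho>\<^sup>2"
        using \<eta>(1) M0 \<rho> by auto
    qed (fact \<eta>(2))
    moreover have "\<exists>M. \<forall>\<^sub>F \<epsilon> in at_right 0. \<forall>y\<in>ball x0 s.
         norm (nth_vderiv n (\<lambda>y. h \<epsilon> y - f \<epsilon> y) y) \<le> M * \<epsilon> powr b" for n b
    proof -
      obtain M' where M': "\<forall>\<^sub>F \<epsilon> in at_right 0. \<forall>y\<in>U x.
          norm (nth_vderiv n (\<lambda>y. h \<epsilon> y - g x \<epsilon> y) y) \<le> M' * \<epsilon> powr b"
        using diff_growth [OF x\<omega>] by blast
      \<comment> \<open>A small b violates -a \<le> b; passing to max b (-a) only strengthens the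
        decay.\<close>
      have "- a \<le> max b (- a)" by simp
      from estimates [OF this] M' eventually_unit_interval
      have "\<forall>\<^sub>F \<epsilon> in at_right 0. \<forall>y\<in>ball x0 s. norm (nth_vderiv n (\<lambda>y. h \<epsilon> y - f \<epsilon> y) y) \<le>
          (M' + fact n * M * (64 / \<rho>\<^sup>2) ^ n) * \<epsilon> powr b"
      proof eventually_elim
        case (elim \<epsilon>)
        show ?case
        proof
          fix y assume y: "y \<in> ball x0 s"
          then have yU: "y \<in> U x" using s ball_U by blast
          have sm: "smooth_on (ball x (r x)) (h \<epsilon>)" "smooth_on (ball x (r x)) (g x \<epsilon>)"
            using rg(3) [OF x\<omega>] elim(3) by (auto intro!: moderate_nets_smooth_on simp: colombeau_rel_def)
          \<comment> \<open>The local representative is inserted: h - g is small by negligibility, f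
            - g by the estimates above.\<close>
          have "nth_vderiv n (\<lambda>y. h \<epsilon> y - f \<epsilon> y) y =
              nth_vderiv n (\<lambda>y. (h \<epsilon> y - g x \<epsilon> y) - (f \<epsilon> y - g x \<epsilon> y)) y"
            by simp
          also have "\<dots> = nth_vderiv n (\<lambda>y. h \<epsilon> y - g x \<epsilon> y) y - nth_vderiv n (\<lambda>y. f \<epsilon> y - g x \<epsilon> y) y"
            by (rule nth_vderiv_diff [OF open_ball smooth_on_diff [OF open_ball sm]
                  smooth_on_diff [OF open_ball smooth_f [OF elim(3)] sm(2)]]) (use yU U_ball in blast)
          also have "norm \<dots> \<le> M' * \<epsilon> powr b + fact n * (M * \<epsilon> powr max b (- a)) * (64 / \<rho>\<^sup>2) ^ n"
            using elim(1,2) y yU by (intro order_trans [OF norm_triangle_ineq4] add_mono) auto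
          also have "\<dots> \<le> M' * \<epsilon> powr b + fact n * (M * \<epsilon> powr b) * (64 / \<rho>\<^sup>2) ^ n"
            using elim(3) M0 by (intro add_mono mult_right_mono mult_left_mono powr_mono') auto
          also have "\<dots> = (M' + fact n * M * (64 / \<rho>\<^sup>2) ^ n) * \<epsilon> powr b"
            by (simp add: distrib_right)
          finally show "norm (nth_vderiv n (\<lambda>y. h \<epsilon> y - f \<epsilon> y) y) \<le>
              (M' + fact n * M * (64 / \<rho>\<^sup>2) ^ n) * \<epsilon> powr b" .
        qed
      qed
      then show ?thesis by blast
    qed
    moreover have "ball x0 s \<subseteq> \<omega>"
      using s ball_U U_ball rg(2) [OF x\<omega>] by blast
    ultimately show ?thesis using s(1) by blast
  qed

  \<comment> \<open>From local estimates to the global class\<close>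
  have "f \<in> smooth_nets \<omega>"
    using smooth_f by (simp add: smooth_nets_def)
  moreover have "(\<lambda>\<epsilon> x. h \<epsilon> x - f \<epsilon> x) \<in> negligible_nets \<omega>"
  proof (rule negligible_nets_locally)
    show "(\<lambda>\<epsilon> x. h \<epsilon> x - f \<epsilon> x) \<in> smooth_nets \<omega>"
      using smooth_on_diff [OF assms(1) moderate_nets_smooth_on [OF h(1)] smooth_f]
      by (simp add: smooth_nets_def)
  qed (use local in blast)
  ultimately have hf: "(h, f) \<in> colombeau_rel \<omega>" and f: "f \<in> moderate_nets \<omega>"
    using moderate_nets_negligible_perturbation [OF assms(1) h(1)] h(1) by (auto simp: colombeau_rel_def)
  have F: "F = colombeau_class \<omega> f"
    unfolding h(2) colombeau_class_def
    using equiv_class_eq [OF equiv_colombeau_rel [OF assms(1)] hf] .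
  show ?thesis
  proof (intro bexI [OF _ f] conjI F ballI analytic)
    fix x0 assume "x0 \<in> \<omega>"
    then obtain s where "0 < s" "ball x0 s \<subseteq> \<omega>" "analytic_bounds (ball x0 s) f"
      using local by blast
    then show "\<exists>r>0. ball x0 r \<subseteq> \<omega> \<and>
        colombeau_restrict (ball x0 r) F = colombeau_class (ball x0 r) f \<and> analytic_bounds (ball x0 r) f"
      using colombeau_restrict_class [OF assms(1) open_ball _ f] F by blast
  qed
qed

end
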